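(* If $M=2$ and $\eta=0$, then the robust optimization problem $\max_{S\in\mathcal{S}}\min_{\lambda\in\mathcal{U}}\mathscr{R}^\lambda(S)$ can be solved in $\mathcal{O}(n^5\log(n r_n))$ time.
   Context: Products: $\mathcal{N}=\{1,\dots,n\}$, and $0$ is the no-purchase option; $\mathcal{N}_0=\mathcal{N}\cup\{0\}$. Revenues satisfy $0=r_0<r_1<\cdots<r_n$, and in this result $r_1,\dots,r_n$ are positive integers. An assortment is a subset of $\mathcal{N}_0$, and $\mathcal{S}=\{S\subseteq\mathcal{N}_0: 0\in S\}$. Data: past assortments $S_1,\dots,S_M\subseteq\mathcal{N}_0$ with index set $\mathcal{M}=\{1,\dots,M\}$, and historical sales data $v_{m,i}\in[0,1]$ ($m\in\mathcal{M}$, $i\in\mathcal{N}_0$) with $\sum_{i\in\mathcal{N}_0}v_{m,i}=1$ for each $m$ and $v_{m,i}=0$ for $i\notin S_m$. Standing assumption: $\bigcup_{m\in\mathcal{M}}S_m=\mathcal{N}_0$. Ranking-based choice models: $\Sigma$ is the set of all rankings, i.e. bijections $\sigma:\mathcal{N}_0\to\{0,\dots,n\}$. $\Delta_\Sigma$ is the set of probability distributions $\lambda=(\lambda_\sigma)_{\sigma\in\Sigma}$ on $\Sigma$. For $\lambda\in\Delta_\Sigma$ and an assortment $S$, $\mathscr{D}^\lambda_i(S)=\sum_{\sigma\in\Sigma}\mathbb{I}\{i=\arg\min_{j\in S}\sigma(j)\}\lambda_\sigma$ and $\mathscr{R}^\lambda(S)=\sum_{i\in\mathcal{N}_0}r_i\mathscr{D}^\lambda_i(S)$.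 Uncertainty set: for a radius $\eta\ge 0$ and $\|\cdot\|$ either the $\ell_1$- or $\ell_\infty$-norm, $\mathcal{U}$ is the set of $\lambda\in\Delta_\Sigma$ for which there is a vector $\epsilon=(\epsilon_{m,i})_{m\in\mathcal{M},i\in S_m}$ with $\|\epsilon\|\le\eta$ and $\mathscr{D}^\lambda_i(S_m)-v_{m,i}=\epsilon_{m,i}$ for all $m\in\mathcal{M}$, $i\in S_m$. Standing assumption: $\mathcal{U}\neq\emptyset$. The input of the problem consists of $n$, $r$, the past assortments and the data $v$; solving it means outputting an optimal assortment and the optimal value. Time counts elementary operations, with arithmetic operations and comparisons on the data counted at unit cost. *)

theory Defs
  imports Complex_Main "HOL-Library.FuncSet"
begin

section \<open>The robust assortment problem\<close>

text \<open>
  Product 0 is the no-purchase option, and past assortments are numbered from 1. Only the values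
  of the functions on the relevant ranges (products up to \<open>num_products\<close>, past assortments from 1
  to \<open>num_past\<close>) are meaningful.
\<close>

record assortment_data =
  num_products :: nat
  revenue :: "nat \<Rightarrow> real"
  num_past :: nat
  past :: "nat \<Rightarrow> nat set"
  sales :: "nat \<Rightarrow> nat \<Rightarrow> real"

definition products0 :: "assortment_data \<Rightarrow> nat set" where
  "products0 I = {0..num_products I}"

definition past_indices :: "assortment_data \<Rightarrow> nat set" where
  "past_indices I = {1..num_past I}"

definition wf_data :: "assortment_data \<Rightarrow> bool" where
  "wf_data I \<longleftrightarrow>
     num_products I \<ge> 1 \<and>
     revenue I 0 = 0 \<and>
     strict_mono_on (products0 I) (revenue I) \<and>
     (\<forall>m\<in>past_indices I. past I m \<subseteq> products0 I) \<and>
     (\<forall>m\<in>past_indices I. \<forall>i\<in>products0 I. 0 \<le> sales I m i \<and> sales I m i \<le> 1) \<and>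
     (\<forall>m\<in>past_indices I. (\<Sum>i\<in>products0 I. sales I m i) = 1) \<and>
     (\<forall>m\<in>past_indices I. \<forall>i\<in>products0 I. i \<notin> past I m \<longrightarrow> sales I m i = 0) \<and>
     (\<Union>m\<in>past_indices I. past I m) = products0 I"

definition integer_revenues :: "assortment_data \<Rightarrow> bool" where
  "integer_revenues I \<longleftrightarrow> (\<forall>i\<in>{1..num_products I}. revenue I i \<in> \<int>)"

definition assortments :: "assortment_data \<Rightarrow> nat set set" where
  "assortments I = {S. S \<subseteq> products0 I \<and> 0 \<in> S}"

text \<open>
  Extensionality (value \<open>undefined\<close> outside the products) makes the set of rankings finite, with
  exactly one representative per bijection.
\<close>

definition rankings :: "assortment_data \<Rightarrow> (nat \<Rightarrow> nat) set" where
  "rankings I =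
     {\<sigma> \<in> extensional (products0 I). bij_betw \<sigma> (products0 I) {0..num_products I}}"

definition ranking_dists :: "assortment_data \<Rightarrow> ((nat \<Rightarrow> nat) \<Rightarrow> real) set" where
  "ranking_dists I =
     {l. (\<forall>\<sigma>\<in>rankings I. 0 \<le> l \<sigma>) \<and> (\<Sum>\<sigma>\<in>rankings I. l \<sigma>) = 1}"

definition choice_prob ::
    "assortment_data \<Rightarrow> ((nat \<Rightarrow> nat) \<Rightarrow> real) \<Rightarrow> nat set \<Rightarrow> nat \<Rightarrow> real" where
  "choice_prob I l S i = (\<Sum>\<sigma>\<in>rankings I. of_bool (i = arg_min_on \<sigma> S) * l \<sigma>)"

definition expected_revenue ::
    "assortment_data \<Rightarrow> ((nat \<Rightarrow> nat) \<Rightarrow> real) \<Rightarrow> nat set \<Rightarrow> real" where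
  "expected_revenue I l S = (\<Sum>i\<in>products0 I. revenue I i * choice_prob I l S i)"

datatype norm_kind = L1 | LInf

fun vec_norm :: "norm_kind \<Rightarrow> 'a set \<Rightarrow> ('a \<Rightarrow> real) \<Rightarrow> real" where
  "vec_norm L1 A x = (\<Sum>a\<in>A. \<bar>x a\<bar>)"
| "vec_norm LInf A x = Max ((\<lambda>a. \<bar>x a\<bar>) ` A)"

definition uncertainty_set ::
    "norm_kind \<Rightarrow> real \<Rightarrow> assortment_data \<Rightarrow> ((nat \<Rightarrow> nat) \<Rightarrow> real) set" where
  "uncertainty_set N \<eta> I =
     {l \<in> ranking_dists I. \<exists>\<epsilon> :: nat \<times> nat \<Rightarrow> real.
        vec_norm N (Sigma (past_indices I) (past I)) \<epsilon> \<le> \<eta> \<and>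
        (\<forall>m\<in>past_indices I. \<forall>i\<in>past I m.
           choice_prob I l (past I m) i - sales I m i = \<epsilon> (m, i))}"

definition has_minimum :: "('a \<Rightarrow> real) \<Rightarrow> 'a set \<Rightarrow> real \<Rightarrow> bool" where
  "has_minimum f A z \<longleftrightarrow> z \<in> f ` A \<and> (\<forall>x\<in>A. z \<le> f x)"

text \<open>
  \<open>S\<close> is a maximizer and \<open>z\<close> the optimal value of the max-min problem; the inner minimum is
  required to be attained for every assortment.
\<close>

definition robust_optimum ::
    "norm_kind \<Rightarrow> real \<Rightarrow> assortment_data \<Rightarrow> nat set \<Rightarrow> real \<Rightarrow> bool" where
  "robust_optimum N \<eta> I S z \<longleftrightarrow>
     S \<in> assortments I \<and>
     has_minimum (\<lambda>l. expected_revenue I l S) (uncertainty_set N \<eta> I) z \<and>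
     (\<forall>S'\<in>assortments I. \<exists>z'\<le>z.
        has_minimum (\<lambda>l. expected_revenue I l S') (uncertainty_set N \<eta> I) z')"


section \<open>A unit-cost random access machine over the reals\<close>

text \<open>
  The memory consists of named arrays of natural numbers (sizes, indices, flags) and named arrays
  of reals (data); a scalar is the cell 0 of an array. Reals can be combined by the four arithmetic
  operations and compared, but not rounded or used as addresses, and naturals can be added,
  multiplied and subtracted (truncated at 0), but not divided. Program constants are integers, so a
  program cannot carry real-valued advice. Every operation, comparison, constant, memory access and
  control step has cost 1.
\<close>

type_synonym mem = "(string \<Rightarrow> nat \<Rightarrow> nat) \<times> (string \<Rightarrow> nat \<Rightarrow> real)"

datatype nexp =
    NConst nat
  | NCell string nexp
  | NAdd nexp nexp
  | NSub nexp nexp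
  | NMul nexp nexp

datatype rexp =
    RConst int
  | ROfNat nexp
  | RCell string nexp
  | RAdd rexp rexp
  | RSub rexp rexp
  | RMul rexp rexp
  | RDiv rexp rexp

datatype bexp =
    NLess nexp nexp
  | NEq nexp nexp
  | RLess rexp rexp
  | REq rexp rexp
  | BNot bexp
  | BAnd bexp bexp

datatype prog =
    Skip
  | NAssign string nexp nexp
  | RAssign string nexp rexp
  | Seq prog prog
  | Cond bexp prog prog
  | While bexp prog

fun nval :: "nexp \<Rightarrow> mem \<Rightarrow> nat" where
  "nval (NConst k) s = k"
| "nval (NCell x a) s = fst s x (nval a s)"
| "nval (NAdd a b) s = nval a s + nval b s"
| "nval (NSub a b) s = nval a s - nval b s"
| "nval (NMul a b) s = nval a s * nval b s"

fun rval :: "rexp \<Rightarrow> mem \<Rightarrow> real" where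
  "rval (RConst k) s = of_int k"
| "rval (ROfNat a) s = of_nat (nval a s)"
| "rval (RCell x a) s = snd s x (nval a s)"
| "rval (RAdd a b) s = rval a s + rval b s"
| "rval (RSub a b) s = rval a s - rval b s"
| "rval (RMul a b) s = rval a s * rval b s"
| "rval (RDiv a b) s = rval a s / rval b s"

fun bval :: "bexp \<Rightarrow> mem \<Rightarrow> bool" where
  "bval (NLess a b) s \<longleftrightarrow> nval a s < nval b s"
| "bval (NEq a b) s \<longleftrightarrow> nval a s = nval b s"
| "bval (RLess a b) s \<longleftrightarrow> rval a s < rval b s"
| "bval (REq a b) s \<longleftrightarrow> rval a s = rval b s"
| "bval (BNot b) s \<longleftrightarrow> \<not> bval b s"
| "bval (BAnd b c) s \<longleftrightarrow> bval b s \<and> bval c s"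

fun ncost :: "nexp \<Rightarrow> nat" where
  "ncost (NConst k) = 1"
| "ncost (NCell x a) = 1 + ncost a"
| "ncost (NAdd a b) = 1 + ncost a + ncost b"
| "ncost (NSub a b) = 1 + ncost a + ncost b"
| "ncost (NMul a b) = 1 + ncost a + ncost b"

fun rcost :: "rexp \<Rightarrow> nat" where
  "rcost (RConst k) = 1"
| "rcost (ROfNat a) = 1 + ncost a"
| "rcost (RCell x a) = 1 + ncost a"
| "rcost (RAdd a b) = 1 + rcost a + rcost b"
| "rcost (RSub a b) = 1 + rcost a + rcost b"
| "rcost (RMul a b) = 1 + rcost a + rcost b"
| "rcost (RDiv a b) = 1 + rcost a + rcost b"

fun bcost :: "bexp \<Rightarrow> nat" where
  "bcost (NLess a b) = 1 + ncost a + ncost b"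
| "bcost (NEq a b) = 1 + ncost a + ncost b"
| "bcost (RLess a b) = 1 + rcost a + rcost b"
| "bcost (REq a b) = 1 + rcost a + rcost b"
| "bcost (BNot b) = 1 + bcost b"
| "bcost (BAnd b c) = 1 + bcost b + bcost c"

text \<open>
  \<open>exec c s t s'\<close>: started in memory \<open>s\<close>, program \<open>c\<close> terminates after \<open>t\<close> elementary operations in
  memory \<open>s'\<close>. The rules are deterministic and have no instance for diverging runs.
\<close>

inductive exec :: "prog \<Rightarrow> mem \<Rightarrow> nat \<Rightarrow> mem \<Rightarrow> bool" where
  Skip: "exec Skip s 1 s"
| NAssign: "exec (NAssign x a e) s (1 + ncost a + ncost e)
     ((fst s)(x := (fst s x)(nval a s := nval e s)), snd s)"
| RAssign: "exec (RAssign x a e) s (1 + ncost a + rcost e)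
     (fst s, (snd s)(x := (snd s x)(nval a s := rval e s)))"
| Seq: "exec c s t s' \<Longrightarrow> exec d s' u s'' \<Longrightarrow> exec (Seq c d) s (t + u) s''"
| CondTrue: "bval b s \<Longrightarrow> exec c s t s' \<Longrightarrow> exec (Cond b c d) s (1 + bcost b + t) s'"
| CondFalse: "\<not> bval b s \<Longrightarrow> exec d s t s' \<Longrightarrow> exec (Cond b c d) s (1 + bcost b + t) s'"
| WhileFalse: "\<not> bval b s \<Longrightarrow> exec (While b c) s (1 + bcost b) s"
| WhileTrue: "bval b s \<Longrightarrow> exec c s t s' \<Longrightarrow> exec (While b c) s' u s'' \<Longrightarrow>
     exec (While b c) s (1 + bcost b + t + u) s''"


section \<open>Input and output\<close>

text \<open>
  The cells \<open>n\<close> and \<open>M\<close> hold the numbers of products and of past assortments. The arrays \<open>S\<close>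
  (membership flags of the past assortments) and \<open>v\<close> (sales data) are stored row by row: the entry
  of past assortment \<open>m\<close> and product \<open>i\<close> is at address \<open>(m - 1) * (n + 1) + i\<close>. All other memory is 0.
\<close>

definition input_mem :: "assortment_data \<Rightarrow> mem" where
  "input_mem I =
     (let n = num_products I; M = num_past I;
          row = (\<lambda>k. k div (n + 1) + 1); col = (\<lambda>k. k mod (n + 1))
      in (\<lambda>x k.
            if x = ''n'' \<and> k = 0 then n
            else if x = ''M'' \<and> k = 0 then M
            else if x = ''S'' \<and> row k \<le> M \<and> col k \<in> past I (row k) then 1
            else 0,
          \<lambda>x k.
            if x = ''r'' \<and> k \<le> n then revenue I k
            else if x = ''v'' \<and> row k \<le> M then sales I (row k) (col k)
            else 0))"

definition output_assortment :: "assortment_data \<Rightarrow> mem \<Rightarrow> nat set" where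
  "output_assortment I s = {i \<in> products0 I. fst s ''assortment'' i \<noteq> 0}"

definition output_value :: "mem \<Rightarrow> real" where
  "output_value s = snd s ''value'' 0"

text \<open>
  One program and one constant serve all instances of the class \<open>K\<close>. The standing assumption that
  the uncertainty set is nonempty is part of the notion.
\<close>

definition robust_solvable_in_time ::
    "norm_kind \<Rightarrow> real \<Rightarrow> assortment_data set \<Rightarrow> (assortment_data \<Rightarrow> real) \<Rightarrow> bool" where
  "robust_solvable_in_time N \<eta> K f \<longleftrightarrow>
     (\<exists>(P :: prog) (C :: real). \<forall>I\<in>K.
        wf_data I \<and> uncertainty_set N \<eta> I \<noteq> {} \<longrightarrow>
        (\<exists>t s. exec P (input_mem I) t s \<and> real t \<le> C * f I \<and>
               robust_optimum N \<eta> I (output_assortment I s) (output_value s)))"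

end

theory Submission
  imports Defs
begin

text \<open>
  Let \<open>S1\<close>, \<open>S2\<close> be the two past assortments and \<open>p\<close>, \<open>q\<close> their sales data. With radius 0 a
  distribution over rankings is admissible iff the favourite products in \<open>S1\<close> and in \<open>S2\<close> are
  distributed as \<open>p\<close> and \<open>q\<close>. The worst-case revenue of an assortment \<open>S\<close> is therefore a linear
  program, and its dual asks for potentials \<open>\<alpha>\<close> on \<open>S1\<close> and \<open>\<beta>\<close> on \<open>S2\<close> such that, for every ranking,
  the potentials of the two past favourites add up to at most the revenue of the favourite in \<open>S\<close>.

  The maximization over \<open>S\<close> and the maximization over the potentials can be done together, and then
  both have only three degrees of freedom. Given potentials for any \<open>S\<close>, let \<open>z\<close> be the sum of
  their maxima, \<open>x\<close> the largest sum of the potential of an unoffered product of \<open>S1 - S2\<close> and the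
  maximum of \<open>\<beta>\<close> (but at least 0), and \<open>y\<close> the same with the roles exchanged. The constraints
  coming from a few rankings bound all potentials in terms of \<open>x\<close>, \<open>y\<close>, \<open>z\<close>, and the dual
  objective is at most an explicit number \<open>dual_value x y z\<close> that does not mention \<open>S\<close> any more
  (\<open>potentials_dominated\<close>). Conversely, \<open>dual_value x y z\<close> is the value of feasible potentials
  for one particular assortment: \<open>offered x y\<close> consists of \<open>S1 \<inter> S2\<close>, of the products of \<open>S1 - S2\<close>
  with revenue at least \<open>x\<close>, and of the products of \<open>S2 - S1\<close> with revenue at least \<open>y\<close>
  (\<open>potential_le_revenue\<close>). By strong duality (\<open>lp_strong_duality\<close>) the optimal value is the
  maximum of \<open>dual_value\<close> over \<open>0 \<le> x\<close>, \<open>0 \<le> y\<close>, \<open>x + y \<le> z\<close>, with \<open>x\<close> or \<open>y\<close> fixed to 0 if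
  otherwise the no-purchase option would not be offered.

  \<open>dual_value\<close> is the sum of a function of \<open>x\<close>, a function of \<open>y\<close> and a function of \<open>z\<close>, each of
  them affine between consecutive revenues. The only constraint that couples the coordinates is
  \<open>x + y \<le> z\<close>, so a maximizer exists in which two coordinates are revenues and the third is a
  revenue or makes this constraint tight (\<open>region_dominated\<close>); here 0 counts as a revenue, that of
  the no-purchase option. Every triple of products yields four such points, and one evaluation of
  \<open>dual_value\<close> takes linear time. Trying all of them takes
  \<open>O(n ^ 4)\<close> operations, which is below the claimed bound because \<open>n \<ge> 1\<close> and the logarithmic
  factor is at least 1.
\<close>

section \<open>Linear programming duality\<close>

text \<open>
  A pair \<open>(f, c)\<close> stands for the inequality \<open>(\<Sum>v\<in>V. f v * x v) \<le> c\<close>. Closure under sums and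
  nonnegative multiples is all that variable elimination uses; explicit multipliers would have to
  be tracked through a system that changes at every step.
\<close>

inductive_set consequences :: "(('v \<Rightarrow> real) \<times> real) set \<Rightarrow> (('v \<Rightarrow> real) \<times> real) set"
  for K where
  hyp: "k \<in> K \<Longrightarrow> k \<in> consequences K"
| scale: "k \<in> consequences K \<Longrightarrow> 0 \<le> c \<Longrightarrow> (\<lambda>v. c * fst k v, c * snd k) \<in> consequences K"
| add: "k \<in> consequences K \<Longrightarrow> l \<in> consequences K \<Longrightarrow>
    (\<lambda>v. fst k v + fst l v, snd k + snd l) \<in> consequences K"

lemma consequences_trans:
  assumes "k \<in> consequences K'" "K' \<subseteq> consequences K"
  shows "k \<in> consequences K"
  using assms by (induction rule: consequences.induct) (auto intro: consequences.intros)

lemma consequences_vanish: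
  assumes "k \<in> consequences K" "\<And>l. l \<in> K \<Longrightarrow> fst l v = 0"
  shows "fst k v = 0"
  using assms by (induction rule: consequences.induct) auto

lemma real_between:
  fixes L U :: "real set"
  assumes "finite L" "finite U" "\<And>l u. l \<in> L \<Longrightarrow> u \<in> U \<Longrightarrow> l \<le> u"
  obtains t where "\<And>l. l \<in> L \<Longrightarrow> l \<le> t" "\<And>u. u \<in> U \<Longrightarrow> t \<le> u"
proof (cases "L = {}")
  case True
  show ?thesis
  proof (cases "U = {}")
    case True with \<open>L = {}\<close> show ?thesis using that by blast
  next
    case False with \<open>L = {}\<close> assms show ?thesis by (intro that[of "Min U"]) auto
  qed
next
  case False with assms show ?thesis by (intro that[of "Max L"]) auto
qed

text \<open>
  A variable \<open>v\<close> is eliminated by adding, for each inequality with a positive and each with a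
  negative coefficient of \<open>v\<close>, the multiples in which these coefficients cancel. The new system
  says that every lower bound which the other variables impose on \<open>v\<close> is at most every upper
  bound, so a solution of it extends to \<open>v\<close>.
\<close>

lemma fourier_motzkin:
  assumes "finite V" "finite K"
    "\<nexists>x. \<forall>k\<in>K. (\<Sum>v\<in>V. fst k v * x v) \<le> snd k"
  shows "\<exists>k\<in>consequences K. (\<forall>v\<in>V. fst k v = 0) \<and> snd k < (0::real)"
  using assms
proof (induction V arbitrary: K rule: finite_induct)
  case empty
  then obtain k where "k \<in> K" "snd k < 0" by (auto simp: not_le)
  then show ?case by (auto intro: consequences.hyp)
next
  case (insert v V)
  define P where "P = {k \<in> K. fst k v > 0}"
  define Q where "Q = {k \<in> K. fst k v < 0}"
  define comb where "comb = (\<lambda>(p :: ('a \<Rightarrow> real) \<times> real, q :: ('a \<Rightarrow> real) \<times> real).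
    (\<lambda>w. (1 / fst p v) * fst p w + (- 1 / fst q v) * fst q w,
     (1 / fst p v) * snd p + (- 1 / fst q v) * snd q))"
  define K' where "K' = {k \<in> K. fst k v = 0} \<union> comb ` (P \<times> Q)"
  have fin: "finite P" "finite Q" "finite K'"
    using insert.prems(1) by (auto simp: P_def Q_def K'_def)
  have comb_in: "comb (p, q) \<in> consequences K" if "p \<in> P" "q \<in> Q" for p q
  proof -
    have "(\<lambda>w. (1 / fst p v) * fst p w, (1 / fst p v) * snd p) \<in> consequences K"
      using that by (intro consequences.scale consequences.hyp) (auto simp: P_def)
    moreover have "(\<lambda>w. (- 1 / fst q v) * fst q w, (- 1 / fst q v) * snd q) \<in> consequences K"
      using that by (intro consequences.scale consequences.hyp)
        (auto simp: Q_def divide_nonpos_neg)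
    ultimately show ?thesis
      unfolding comb_def using consequences.add by fastforce
  qed
  have sub: "K' \<subseteq> consequences K"
    using comb_in by (auto simp: K'_def intro: consequences.hyp)
  have zero: "fst l v = 0" if "l \<in> K'" for l
    using that by (auto simp: K'_def comb_def P_def Q_def)
  have "\<nexists>x. \<forall>k\<in>K'. (\<Sum>w\<in>V. fst k w * x w) \<le> snd k"
  proof
    assume "\<exists>x. \<forall>k\<in>K'. (\<Sum>w\<in>V. fst k w * x w) \<le> snd k"
    then obtain x where x: "\<And>k. k \<in> K' \<Longrightarrow> (\<Sum>w\<in>V. fst k w * x w) \<le> snd k" by blast
    define bd where "bd = (\<lambda>k. (snd k - (\<Sum>w\<in>V. fst k w * x w)) / fst k v)"
    have "bd q \<le> bd p" if "p \<in> P" "q \<in> Q" for p q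
    proof -
      have "comb (p, q) \<in> K'" using that by (auto simp: K'_def)
      from x[OF this] have "(1 / fst p v) * (\<Sum>w\<in>V. fst p w * x w)
          + (- 1 / fst q v) * (\<Sum>w\<in>V. fst q w * x w)
          \<le> (1 / fst p v) * snd p + (- 1 / fst q v) * snd q"
        by (simp add: comb_def left_diff_distrib sum_subtractf sum_divide_distrib)
      then show ?thesis by (simp add: bd_def diff_divide_distrib)
    qed
    then have "l \<le> u" if "l \<in> bd ` Q" "u \<in> bd ` P" for l u using that by blast
    then obtain t where "\<And>l. l \<in> bd ` Q \<Longrightarrow> l \<le> t" "\<And>u. u \<in> bd ` P \<Longrightarrow> t \<le> u"
      using real_between[of "bd ` Q" "bd ` P"] fin by blast
    then have t: "\<And>q. q \<in> Q \<Longrightarrow> bd q \<le> t" "\<And>p. p \<in> P \<Longrightarrow> t \<le> bd p" by blast+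
    have "(\<Sum>w\<in>insert v V. fst k w * (x(v := t)) w) \<le> snd k" if "k \<in> K" for k
    proof -
      have "(\<Sum>w\<in>V. fst k w * (x(v := t)) w) = (\<Sum>w\<in>V. fst k w * x w)"
        using insert.hyps by (intro sum.cong) auto
      then have eq: "(\<Sum>w\<in>insert v V. fst k w * (x(v := t)) w)
          = fst k v * t + (\<Sum>w\<in>V. fst k w * x w)"
        using insert.hyps by simp
      consider "k \<in> P" | "k \<in> Q" | "fst k v = 0"
        using \<open>k \<in> K\<close> less_linear[of "fst k v" 0] unfolding P_def Q_def by blast
      then show ?thesis
      proof cases
        case 1
        then have "t \<le> bd k" "fst k v > 0" using t by (auto simp: P_def)
        then show ?thesis unfolding eq bd_def by (simp add: field_simps)
      next
        case 2
        then have "bd k \<le> t" "fst k v < 0" using t by (auto simp: Q_def)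
        then show ?thesis unfolding eq bd_def by (simp add: field_simps)
      next
        case 3
        then have "k \<in> K'" using \<open>k \<in> K\<close> by (auto simp: K'_def)
        from x[OF this] 3 show ?thesis unfolding eq by simp
      qed
    qed
    then show False using insert.prems(2) by blast
  qed
  from insert.IH[OF fin(3) this] obtain k where k: "k \<in> consequences K'"
    "\<forall>w\<in>V. fst k w = 0" "snd k < 0" by blast
  have "k \<in> consequences K" using consequences_trans[OF k(1) sub] .
  moreover have "fst k v = 0" using consequences_vanish[OF k(1) zero] .
  ultimately show ?case using k by auto
qed

lemma farkas:
  fixes a :: "'j \<Rightarrow> 'v \<Rightarrow> real"
  assumes "finite V" "finite J"
    "\<nexists>x. \<forall>j\<in>J. (\<Sum>v\<in>V. a j v * x v) \<le> b j"
  obtains u where "\<And>j. 0 \<le> u j" "\<And>v. v \<in> V \<Longrightarrow> (\<Sum>j\<in>J. u j * a j v) = 0"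
    "(\<Sum>j\<in>J. u j * b j) < 0"
proof -
  have comb: "\<exists>u. (\<forall>j. 0 \<le> u j) \<and> k = (\<lambda>v. \<Sum>j\<in>J. u j * a j v, \<Sum>j\<in>J. u j * b j)"
    if "k \<in> consequences ((\<lambda>j. (a j, b j)) ` J)" for k
    using that
  proof (induction rule: consequences.induct)
    case (hyp k)
    then obtain i where i: "i \<in> J" "k = (a i, b i)" by auto
    have "k = (\<lambda>v. \<Sum>j\<in>J. of_bool (j = i) * a j v, \<Sum>j\<in>J. of_bool (j = i) * b j)"
      using i \<open>finite J\<close> by (simp add: of_bool_def if_distrib[of "\<lambda>t. t * _"] cong: if_cong)
    then show ?case by (intro exI[of _ "\<lambda>j. of_bool (j = i)"]) simp
  next
    case (scale k c)
    then obtain u where u: "\<forall>j. 0 \<le> u j"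
      "k = (\<lambda>v. \<Sum>j\<in>J. u j * a j v, \<Sum>j\<in>J. u j * b j)" by blast
    then show ?case using scale.hyps
      by (intro exI[of _ "\<lambda>j. c * u j"]) (auto simp: sum_distrib_left mult.assoc)
  next
    case (add k l)
    then obtain u u' where u: "\<forall>j. 0 \<le> u j"
      "k = (\<lambda>v. \<Sum>j\<in>J. u j * a j v, \<Sum>j\<in>J. u j * b j)" and u': "\<forall>j. 0 \<le> u' j"
      "l = (\<lambda>v. \<Sum>j\<in>J. u' j * a j v, \<Sum>j\<in>J. u' j * b j)" by blast
    then show ?case
      by (intro exI[of _ "\<lambda>j. u j + u' j"]) (auto simp: sum.distrib distrib_right)
  qed
  have "\<nexists>x. \<forall>k\<in>(\<lambda>j. (a j, b j)) ` J. (\<Sum>v\<in>V. fst k v * x v) \<le> snd k"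
    using assms(3) by auto
  from fourier_motzkin[OF assms(1) _ this] assms(2)
  obtain k where k: "k \<in> consequences ((\<lambda>j. (a j, b j)) ` J)"
    "\<forall>v\<in>V. fst k v = 0" "snd k < 0" by auto
  from comb[OF k(1)] obtain u where "\<forall>j. 0 \<le> u j"
      "k = (\<lambda>v. \<Sum>j\<in>J. u j * a j v, \<Sum>j\<in>J. u j * b j)" by blast
  with k that[of u] show ?thesis by simp
qed

lemma sum_Plus_real:
  fixes f :: "'a + 'b \<Rightarrow> real"
  assumes "finite X" "finite Y"
  shows "(\<Sum>v\<in>X <+> Y. f v) = (\<Sum>x\<in>X. f (Inl x)) + (\<Sum>y\<in>Y. f (Inr y))"
  using assms by (simp add: sum.Plus comp_def)

lemma bilinear_swap:
  fixes A :: "'y \<Rightarrow> 'x \<Rightarrow> real"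
  shows "(\<Sum>x\<in>X. (\<Sum>y\<in>Y. A y x * u y) * t x) = (\<Sum>y\<in>Y. u y * (\<Sum>x\<in>X. A y x * t x))"
  by (simp add: sum_distrib_left sum_distrib_right sum.swap[of _ Y] mult.assoc mult.left_commute)

lemma lp_weak_duality:
  fixes A :: "'y \<Rightarrow> 'x \<Rightarrow> real"
  assumes "\<And>x. x \<in> X \<Longrightarrow> 0 \<le> t x" "\<And>y. y \<in> Y \<Longrightarrow> (\<Sum>x\<in>X. A y x * t x) = b y"
    "\<And>x. x \<in> X \<Longrightarrow> (\<Sum>y\<in>Y. A y x * u y) \<le> c x"
  shows "(\<Sum>y\<in>Y. b y * u y) \<le> (\<Sum>x\<in>X. c x * t x)"
proof -
  have "(\<Sum>y\<in>Y. b y * u y) = (\<Sum>y\<in>Y. u y * (\<Sum>x\<in>X. A y x * t x))"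
    using assms(2) by (intro sum.cong) auto
  also have "\<dots> = (\<Sum>x\<in>X. (\<Sum>y\<in>Y. A y x * u y) * t x)" by (simp only: bilinear_swap)
  also have "\<dots> \<le> (\<Sum>x\<in>X. c x * t x)"
    using assms by (intro sum_mono mult_right_mono) auto
  finally show ?thesis .
qed

text \<open>
  The system consisting of primal feasibility, dual feasibility and \<open>c t \<le> b u\<close> is solvable:
  multipliers refuting it would themselves be a primal-dual pair scaled by a number \<open>\<theta> \<ge> 0\<close>.
  For \<open>\<theta> > 0\<close> they violate weak duality, for \<open>\<theta> = 0\<close> they are improving directions that the
  feasible points \<open>t0\<close> and \<open>u0\<close> exclude.
\<close>

lemma lp_strong_duality:
  fixes A :: "'y \<Rightarrow> 'x \<Rightarrow> real"
  assumes fin: "finite X" "finite Y"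
    and primal: "\<And>x. x \<in> X \<Longrightarrow> 0 \<le> t0 x" "\<And>y. y \<in> Y \<Longrightarrow> (\<Sum>x\<in>X. A y x * t0 x) = b y"
    and dual: "\<And>x. x \<in> X \<Longrightarrow> (\<Sum>y\<in>Y. A y x * u0 y) \<le> c x"
  obtains t u where "\<And>x. x \<in> X \<Longrightarrow> 0 \<le> t x" "\<And>y. y \<in> Y \<Longrightarrow> (\<Sum>x\<in>X. A y x * t x) = b y"
    "\<And>x. x \<in> X \<Longrightarrow> (\<Sum>y\<in>Y. A y x * u y) \<le> c x"
    "(\<Sum>x\<in>X. c x * t x) \<le> (\<Sum>y\<in>Y. b y * u y)"
proof -
  define V where "V = X <+> Y"
  define J where "J = ((X <+> Y) <+> (Y <+> X)) <+> {()}"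
  \<comment> \<open>The rows are, in this order, \<open>t \<ge> 0\<close>, \<open>A t \<le> b\<close>, \<open>A t \<ge> b\<close>, the dual constraints, and the
    comparison of the objectives.\<close>
  define a :: "(('x + 'y) + ('y + 'x)) + unit \<Rightarrow> 'x + 'y \<Rightarrow> real" where
    "a = case_sum (case_sum
       (case_sum (\<lambda>x. case_sum (\<lambda>x'. - of_bool (x' = x)) (\<lambda>_. 0))
                 (\<lambda>y. case_sum (\<lambda>x. A y x) (\<lambda>_. 0)))
       (case_sum (\<lambda>y. case_sum (\<lambda>x. - A y x) (\<lambda>_. 0))
                 (\<lambda>x. case_sum (\<lambda>_. 0) (\<lambda>y. A y x))))
       (\<lambda>_. case_sum c (\<lambda>y. - b y))"
  define d :: "(('x + 'y) + ('y + 'x)) + unit \<Rightarrow> real" where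
    "d = case_sum (case_sum (case_sum (\<lambda>_. 0) b) (case_sum (\<lambda>y. - b y) c)) (\<lambda>_. 0)"
  have "\<exists>s. \<forall>j\<in>J. (\<Sum>v\<in>V. a j v * s v) \<le> d j"
  proof (rule ccontr)
    assume "\<nexists>s. \<forall>j\<in>J. (\<Sum>v\<in>V. a j v * s v) \<le> d j"
    moreover have "finite V" "finite J" using fin by (auto simp: V_def J_def)
    ultimately obtain w where w: "\<And>j. 0 \<le> w j" "\<And>v. v \<in> V \<Longrightarrow> (\<Sum>j\<in>J. w j * a j v) = 0"
      "(\<Sum>j\<in>J. w j * d j) < 0" using farkas[of V J a d] by blast
    define s where "s x = w (Inl (Inl (Inl x)))" for x
    define u where "u y = w (Inl (Inl (Inr y))) - w (Inl (Inr (Inl y)))" for y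
    define t where "t x = w (Inl (Inr (Inr x)))" for x
    define \<theta> where "\<theta> = w (Inr ())"
    have pos: "0 \<le> s x" "0 \<le> t x" "0 \<le> \<theta>" for x using w(1) by (auto simp: s_def t_def \<theta>_def)
    have sumJ: "(\<Sum>j\<in>J. f j) = (\<Sum>x\<in>X. f (Inl (Inl (Inl x)))) + (\<Sum>y\<in>Y. f (Inl (Inl (Inr y))))
        + ((\<Sum>y\<in>Y. f (Inl (Inr (Inl y)))) + (\<Sum>x\<in>X. f (Inl (Inr (Inr x))))) + f (Inr ())"
      for f :: "_ \<Rightarrow> real"
      unfolding J_def using fin by (simp add: sum_Plus_real)
    have xrow: "(\<Sum>y\<in>Y. A y x * u y) + \<theta> * c x = s x" if "x \<in> X" for x
    proof -
      have "(\<Sum>j\<in>J. w j * a j (Inl x)) = 0" using w(2)[of "Inl x"] that by (auto simp: V_def)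
      then have "(\<Sum>x'\<in>X. w (Inl (Inl (Inl x'))) * - of_bool (x = x'))
          + (\<Sum>y\<in>Y. w (Inl (Inl (Inr y))) * A y x) + (\<Sum>y\<in>Y. w (Inl (Inr (Inl y))) * - A y x)
          + \<theta> * c x = 0"
        unfolding sumJ by (simp add: a_def \<theta>_def)
      moreover have "(\<Sum>x'\<in>X. w (Inl (Inl (Inl x'))) * - of_bool (x = x')) = - s x"
        using that fin
        by (simp add: s_def of_bool_def if_distrib[of "\<lambda>z. _ * z"]
          if_distrib[of "\<lambda>z. - z"] sum.delta cong: if_cong)
      ultimately show ?thesis
        by (simp add: u_def algebra_simps sum_subtractf sum_negf)
    qed
    have yrow: "(\<Sum>x\<in>X. A y x * t x) = \<theta> * b y" if "y \<in> Y" for y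
    proof -
      have "(\<Sum>j\<in>J. w j * a j (Inr y)) = 0" using w(2)[of "Inr y"] that by (auto simp: V_def)
      then show ?thesis unfolding sumJ by (simp add: a_def \<theta>_def t_def mult.commute)
    qed
    have neg: "(\<Sum>y\<in>Y. b y * u y) + (\<Sum>x\<in>X. c x * t x) < 0"
      using w(3) unfolding sumJ
      by (simp add: d_def u_def t_def algebra_simps sum_subtractf sum_negf)
    show False
    proof (cases "\<theta> = 0")
      case True
      have "0 \<le> (\<Sum>x\<in>X. (\<Sum>y\<in>Y. A y x * u y) * t0 x)"
      proof (rule sum_nonneg)
        fix x assume "x \<in> X"
        with xrow[of x] pos(1)[of x] primal(1)[of x] True
        show "0 \<le> (\<Sum>y\<in>Y. A y x * u y) * t0 x" by simp
      qed
      also have "\<dots> = (\<Sum>y\<in>Y. u y * (\<Sum>x\<in>X. A y x * t0 x))" by (rule bilinear_swap)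
      also have "\<dots> = (\<Sum>y\<in>Y. b y * u y)" using primal(2) by (simp add: mult.commute)
      finally have "0 \<le> (\<Sum>y\<in>Y. b y * u y)" .
      moreover have "(\<Sum>y\<in>Y. (\<theta> * b y) * u0 y) \<le> (\<Sum>x\<in>X. c x * t x)"
        using pos yrow dual by (intro lp_weak_duality) auto
      ultimately show False using neg True by simp
    next
      case False
      then have th: "\<theta> > 0" using pos(3) by simp
      have "(\<Sum>y\<in>Y. (\<theta> * b y) * (- u y / \<theta>)) \<le> (\<Sum>x\<in>X. c x * t x)"
      proof (rule lp_weak_duality)
        show "0 \<le> t x" for x by (rule pos)
        show "(\<Sum>x\<in>X. A y x * t x) = \<theta> * b y" if "y \<in> Y" for y by (rule yrow[OF that])
        show "(\<Sum>y\<in>Y. A y x * (- u y / \<theta>)) \<le> c x" if "x \<in> X" for x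
        proof -
          have "(\<Sum>y\<in>Y. A y x * (- u y / \<theta>)) = - (\<Sum>y\<in>Y. A y x * u y) / \<theta>"
            by (simp add: sum_divide_distrib sum_negf)
          also have "\<dots> \<le> c x" using xrow[OF that] pos(1)[of x] th by (simp add: field_simps)
          finally show ?thesis .
        qed
      qed
      then show False using neg False by (simp add: sum_negf)
    qed
  qed
  then obtain s where s: "\<And>j. j \<in> J \<Longrightarrow> (\<Sum>v\<in>V. a j v * s v) \<le> d j" by blast
  have sumV: "(\<Sum>v\<in>V. f v) = (\<Sum>x\<in>X. f (Inl x)) + (\<Sum>y\<in>Y. f (Inr y))" for f :: "_ \<Rightarrow> real"
    unfolding V_def using fin by (simp add: sum_Plus_real)
  define t where "t x = s (Inl x)" for x
  define u where "u y = s (Inr y)" for y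
  show ?thesis
  proof (rule that)
    fix x assume "x \<in> X"
    then have "(\<Sum>x'\<in>X. - of_bool (x' = x) * s (Inl x')) \<le> 0"
      using s[of "Inl (Inl (Inl x))"] by (auto simp: J_def sumV a_def d_def)
    moreover have "(\<Sum>x'\<in>X. - of_bool (x' = x) * s (Inl x')) = - t x"
      using \<open>x \<in> X\<close> fin
        by (simp add: t_def of_bool_def if_distrib[of "\<lambda>z. z * _"]
          if_distrib[of "\<lambda>z. - z"] sum.delta cong: if_cong)
    ultimately show "0 \<le> t x" by simp
    show "(\<Sum>y\<in>Y. A y x * u y) \<le> c x"
      using s[of "Inl (Inr (Inr x))"] \<open>x \<in> X\<close> by (auto simp: J_def sumV a_def d_def u_def)
  next
    fix y assume "y \<in> Y"
    then have "(\<Sum>x\<in>X. A y x * t x) \<le> b y" "- (\<Sum>x\<in>X. A y x * t x) \<le> - b y"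
      using s[of "Inl (Inl (Inr y))"] s[of "Inl (Inr (Inl y))"]
      by (auto simp: J_def sumV a_def d_def t_def sum_negf)
    then show "(\<Sum>x\<in>X. A y x * t x) = b y" by simp
  next
    have "(\<Sum>x\<in>X. c x * t x) + (\<Sum>y\<in>Y. - b y * u y) \<le> 0"
      using s[of "Inr ()"] by (auto simp: J_def sumV a_def d_def t_def u_def)
    then show "(\<Sum>x\<in>X. c x * t x) \<le> (\<Sum>y\<in>Y. b y * u y)" by (simp add: sum_negf)
  qed
qed

section \<open>Potentials and the dual value\<close>

definition hinge :: "real \<Rightarrow> real" where "hinge t = max 0 t"

locale two_past_assortments =
  fixes I :: assortment_data
  assumes wf: "wf_data I" and two: "num_past I = 2"
begin

abbreviation "P \<equiv> products0 I"
definition S1 :: "nat set" where "S1 = past I 1"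
definition S2 :: "nat set" where "S2 = past I 2"
abbreviation "r \<equiv> revenue I"
definition p :: "nat \<Rightarrow> real" where "p = sales I 1"
definition q :: "nat \<Rightarrow> real" where "q = sales I 2"
abbreviation "fav \<sigma> T \<equiv> arg_min_on \<sigma> T"

lemma finite_P: "finite P" and zero_P: "0 \<in> P" and P_eq: "P = {..num_products I}"
  by (auto simp: products0_def)

lemma past_indices_eq: "past_indices I = {1, 2}"
  using two by (auto simp: past_indices_def)

lemma
  shows S1_sub: "S1 \<subseteq> P" and S2_sub: "S2 \<subseteq> P" and S12: "S1 \<union> S2 = P"
    and p_nonneg: "k \<in> P \<Longrightarrow> 0 \<le> p k" and q_nonneg: "k \<in> P \<Longrightarrow> 0 \<le> q k"
    and p_sum: "sum p P = 1" and q_sum: "sum q P = 1"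
    and p_out: "k \<in> P \<Longrightarrow> k \<notin> S1 \<Longrightarrow> p k = 0" and q_out: "k \<in> P \<Longrightarrow> k \<notin> S2 \<Longrightarrow> q k = 0"
  using wf unfolding wf_data_def past_indices_eq S1_def S2_def p_def q_def by auto

lemma finite_S1: "finite S1" and finite_S2: "finite S2"
  using S1_sub S2_sub finite_P finite_subset by blast+

lemma r_zero: "r 0 = 0" using wf by (simp add: wf_data_def)

lemma r_mono: "i \<in> P \<Longrightarrow> j \<in> P \<Longrightarrow> i \<le> j \<Longrightarrow> r i \<le> r j"
  using wf unfolding wf_data_def strict_mono_on_def by (cases "i = j") (auto simp: less_le)

lemma r_nonneg: "k \<in> P \<Longrightarrow> 0 \<le> r k"
  using r_mono[of 0 k] zero_P r_zero by simp

lemma S1_ne: "S1 \<noteq> {}" and S2_ne: "S2 \<noteq> {}"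
proof -
  show "S1 \<noteq> {}"
  proof
    assume "S1 = {}"
    then have "sum p P = 0" using p_out by simp
    then show False using p_sum by simp
  qed
  show "S2 \<noteq> {}"
  proof
    assume "S2 = {}"
    then have "sum q P = 0" using q_out by simp
    then show False using q_sum by simp
  qed
qed

text \<open>
  The coefficients record by how much the slope of the dual value changes when the parameter
  \<open>x\<close>, \<open>y\<close> or \<open>z\<close> passes the revenue of product \<open>k\<close>.
\<close>

definition coef_x :: "nat \<Rightarrow> real" where
  "coef_x k = (if k \<notin> S2 then p k else if k \<in> S1 then min (p k) (q k) - q k else 0)"
definition coef_y :: "nat \<Rightarrow> real" where
  "coef_y k = (if k \<notin> S1 then q k else if k \<in> S2 then min (p k) (q k) - p k else 0)"
definition coef_z :: "nat \<Rightarrow> real" where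
  "coef_z k = (if k \<notin> S2 then - p k else if k \<notin> S1 then - q k else - min (p k) (q k))"

definition dual_value :: "real \<Rightarrow> real \<Rightarrow> real \<Rightarrow> real" where
  "dual_value x y z = z + (\<Sum>k\<in>P. coef_x k * hinge (x - r k) + coef_y k * hinge (y - r k)
     + coef_z k * hinge (z - r k))"

text \<open>
  Raising \<open>x\<close> withdraws cheap products that occur only in \<open>S1\<close>, raising \<open>y\<close> those that occur only
  in \<open>S2\<close>. Products of both past assortments always stay: removing one only creates
  opportunities for the adversary to choose something cheaper.
\<close>

definition offered :: "real \<Rightarrow> real \<Rightarrow> nat set" where
  "offered x y = {i \<in> P. (i \<in> S2 \<or> x \<le> r i) \<and> (i \<in> S1 \<or> y \<le> r i)}"

text \<open>
  Offering the no-purchase option means \<open>x = 0\<close> if it is missing in \<open>S2\<close>, and \<open>y = 0\<close> if it is missing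
  in \<open>S1\<close>.
\<close>

definition feasible :: "real \<Rightarrow> real \<Rightarrow> real \<Rightarrow> bool" where
  "feasible x y z \<longleftrightarrow> 0 \<le> x \<and> 0 \<le> y \<and> x + y \<le> z \<and> 0 \<in> offered x y"

lemma offered_assortment: "feasible x y z \<Longrightarrow> offered x y \<in> assortments I"
  by (auto simp: feasible_def assortments_def offered_def)

text \<open>
  Because \<open>p\<close> and \<open>q\<close> have total mass 1, the summand \<open>z\<close> can be spread over the products in any
  split \<open>a + b\<close>. This lets the dual value be compared with potentials product by product.
\<close>

lemma dual_value_split:
  assumes "a + b = z"
  shows "dual_value x y z = (\<Sum>k\<in>P. p k * a + q k * b + (coef_x k * hinge (x - r k)
     + coef_y k * hinge (y - r k) + coef_z k * hinge (z - r k)))"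
proof -
  have "(\<Sum>k\<in>P. p k * a) = a" "(\<Sum>k\<in>P. q k * b) = b"
    using p_sum q_sum by (simp_all add: sum_distrib_right[symmetric])
  then show ?thesis using assms by (simp add: dual_value_def sum.distrib)
qed

lemma fav_in:
  fixes \<sigma> :: "nat \<Rightarrow> nat"
  assumes "T \<subseteq> P" "T \<noteq> {}"
  shows "fav \<sigma> T \<in> T" and "t \<in> T \<Longrightarrow> \<sigma> (fav \<sigma> T) \<le> \<sigma> t"
proof -
  have "finite T" using assms finite_P finite_subset by blast
  from arg_min_if_finite[OF this assms(2), of \<sigma>]
  show "fav \<sigma> T \<in> T" "t \<in> T \<Longrightarrow> \<sigma> (fav \<sigma> T) \<le> \<sigma> t" by (auto simp: not_less)
qed

lemma ranking_inj: "\<sigma> \<in> rankings I \<Longrightarrow> inj_on \<sigma> P"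
  by (auto simp: rankings_def bij_betw_def)

lemma fav_eqI:
  assumes "\<sigma> \<in> rankings I" "T \<subseteq> P" "t \<in> T" "\<And>s. s \<in> T \<Longrightarrow> \<sigma> t \<le> \<sigma> s"
  shows "fav \<sigma> T = t"
proof -
  have "T \<noteq> {}" using assms by auto
  note * = fav_in(1)[OF assms(2) this, of \<sigma>] fav_in(2)[OF assms(2) this, of _ \<sigma>]
  have "\<sigma> (fav \<sigma> T) = \<sigma> t" using * assms(3,4) by (metis order_antisym)
  then show ?thesis using ranking_inj[OF assms(1)] * assms by (meson inj_onD subsetD)
qed

lemma finite_rankings: "finite (rankings I)"
proof (rule finite_subset)
  show "rankings I \<subseteq> (\<Pi>\<^sub>E i\<in>P. {0..num_products I})"
    by (auto simp: rankings_def PiE_def bij_betw_def)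
  show "finite (\<Pi>\<^sub>E i\<in>P. {0..num_products I})" using finite_P by (intro finite_PiE) auto
qed

lemma sum_choice_prob:
  assumes "T \<subseteq> P" "T \<noteq> {}"
  shows "(\<Sum>i\<in>T. f i * choice_prob I l T i) = (\<Sum>\<sigma>\<in>rankings I. l \<sigma> * f (fav \<sigma> T))"
proof -
  have fin: "finite T" using assms finite_P finite_subset by blast
  have "(\<Sum>i\<in>T. f i * choice_prob I l T i)
      = (\<Sum>i\<in>T. \<Sum>\<sigma>\<in>rankings I. f i * (of_bool (i = fav \<sigma> T) * l \<sigma>))"
    by (simp add: choice_prob_def sum_distrib_left)
  also have "\<dots> = (\<Sum>\<sigma>\<in>rankings I. \<Sum>i\<in>T. f i * (of_bool (i = fav \<sigma> T) * l \<sigma>))"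
    by (rule sum.swap)
  also have "\<dots> = (\<Sum>\<sigma>\<in>rankings I. l \<sigma> * f (fav \<sigma> T))"
  proof (rule sum.cong[OF refl])
    fix \<sigma>
    have "(\<Sum>i\<in>T. f i * (of_bool (i = fav \<sigma> T) * l \<sigma>))
        = (\<Sum>i\<in>T. if i = fav \<sigma> T then f i * l \<sigma> else 0)" by (intro sum.cong) auto
    also have "\<dots> = l \<sigma> * f (fav \<sigma> T)" using fin fav_in(1)[OF assms, of \<sigma>] by simp
    finally show "(\<Sum>i\<in>T. f i * (of_bool (i = fav \<sigma> T) * l \<sigma>)) = l \<sigma> * f (fav \<sigma> T)" .
  qed
  finally show ?thesis .
qed

lemma expected_revenue_eq:
  assumes "T \<subseteq> P" "T \<noteq> {}"
  shows "expected_revenue I l T = (\<Sum>\<sigma>\<in>rankings I. r (fav \<sigma> T) * l \<sigma>)"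
proof -
  have "choice_prob I l T i = 0" if "i \<in> P - T" for i
    using fav_in(1)[OF assms] that unfolding choice_prob_def by (intro sum.neutral) auto
  then have "expected_revenue I l T = (\<Sum>i\<in>T. r i * choice_prob I l T i)"
    unfolding expected_revenue_def using finite_P assms(1)
    by (intro sum.mono_neutral_right) auto
  then show ?thesis using sum_choice_prob[OF assms] by (simp add: mult.commute)
qed

text \<open>
  The sales in \<open>S1\<close> add up to 1, so \<open>l\<close> automatically has total mass 1.
\<close>

definition consistent :: "((nat \<Rightarrow> nat) \<Rightarrow> real) set" where
  "consistent = {l. (\<forall>\<sigma>\<in>rankings I. 0 \<le> l \<sigma>) \<and>
     (\<forall>i\<in>S1. choice_prob I l S1 i = p i) \<and> (\<forall>i\<in>S2. choice_prob I l S2 i = q i)}"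

lemma uncertainty_set_eq: "uncertainty_set N 0 I = consistent"
proof -
  have fin: "finite (Sigma (past_indices I) (past I))"
    using finite_S1 finite_S2 by (auto simp: past_indices_eq S1_def S2_def)
  have ne: "Sigma (past_indices I) (past I) \<noteq> {}" using S1_ne by (auto simp: past_indices_eq S1_def)
  have norm: "vec_norm N (Sigma (past_indices I) (past I)) \<epsilon> \<le> 0 \<longleftrightarrow>
      (\<forall>a\<in>Sigma (past_indices I) (past I). \<epsilon> a = 0)" for \<epsilon>
  proof (cases N)
    case L1
    have "(\<Sum>a\<in>A. \<bar>\<epsilon> a\<bar>) \<le> 0 \<longleftrightarrow> (\<Sum>a\<in>A. \<bar>\<epsilon> a\<bar>) = 0" for A :: "(nat \<times> nat) set"
    proof -
      have "0 \<le> (\<Sum>a\<in>A. \<bar>\<epsilon> a\<bar>)" by (intro sum_nonneg) simp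
      then show ?thesis by linarith
    qed
    then show ?thesis using L1 fin by (simp add: sum_nonneg_eq_0_iff)
  next
    case LInf
    then show ?thesis using fin ne by simp
  qed
  have sum1: "(\<Sum>\<sigma>\<in>rankings I. l \<sigma>) = 1" if "l \<in> consistent" for l
  proof -
    have "(\<Sum>\<sigma>\<in>rankings I. l \<sigma>) = (\<Sum>i\<in>S1. choice_prob I l S1 i)"
      using sum_choice_prob[OF S1_sub S1_ne, of "\<lambda>_. 1" l] by simp
    also have "\<dots> = (\<Sum>i\<in>S1. p i)" using that by (auto simp: consistent_def)
    also have "\<dots> = sum p P" using p_out finite_P S1_sub by (intro sum.mono_neutral_left) auto
    finally show ?thesis using p_sum by simp
  qed
  have "l \<in> uncertainty_set N 0 I \<longleftrightarrow> l \<in> ranking_dists I \<and>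
      (\<forall>i\<in>S1. choice_prob I l S1 i = p i) \<and> (\<forall>i\<in>S2. choice_prob I l S2 i = q i)" for l
  proof -
    define dev where "dev = (\<lambda>m i. choice_prob I l (past I m) i - sales I m i)"
    have "(\<exists>\<epsilon> :: nat \<times> nat \<Rightarrow> real. vec_norm N (Sigma (past_indices I) (past I)) \<epsilon> \<le> 0 \<and>
        (\<forall>m\<in>past_indices I. \<forall>i\<in>past I m. dev m i = \<epsilon> (m, i)))
      \<longleftrightarrow> (\<forall>m\<in>past_indices I. \<forall>i\<in>past I m. dev m i = 0)"
    proof
      assume "\<forall>m\<in>past_indices I. \<forall>i\<in>past I m. dev m i = 0"
      then show "\<exists>\<epsilon> :: nat \<times> nat \<Rightarrow> real. vec_norm N (Sigma (past_indices I) (past I)) \<epsilon> \<le> 0 \<and>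
          (\<forall>m\<in>past_indices I. \<forall>i\<in>past I m. dev m i = \<epsilon> (m, i))"
        unfolding norm by (intro exI[of _ "\<lambda>_. 0"]) simp
    qed (unfold norm, force)
    also have "\<dots> \<longleftrightarrow>
        (\<forall>i\<in>S1. choice_prob I l S1 i = p i) \<and> (\<forall>i\<in>S2. choice_prob I l S2 i = q i)"
      by (simp add: past_indices_eq dev_def S1_def S2_def p_def q_def)
    finally show ?thesis by (simp add: uncertainty_set_def dev_def)
  qed
  then show ?thesis using sum1 by (auto simp: ranking_dists_def consistent_def)
qed

lemma consistent_sum:
  assumes "l \<in> consistent"
  shows "(\<Sum>\<sigma>\<in>rankings I. l \<sigma> * (\<alpha> (fav \<sigma> S1) + \<beta> (fav \<sigma> S2)))
    = (\<Sum>k\<in>P. p k * \<alpha> k + q k * \<beta> k)"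
proof -
  have "(\<Sum>\<sigma>\<in>rankings I. l \<sigma> * \<alpha> (fav \<sigma> S1)) = (\<Sum>k\<in>S1. p k * \<alpha> k)"
    using assms sum_choice_prob[OF S1_sub S1_ne, of \<alpha> l, symmetric]
    by (auto simp: consistent_def mult.commute intro!: sum.cong)
  moreover have "(\<Sum>\<sigma>\<in>rankings I. l \<sigma> * \<beta> (fav \<sigma> S2)) = (\<Sum>k\<in>S2. q k * \<beta> k)"
    using assms sum_choice_prob[OF S2_sub S2_ne, of \<beta> l, symmetric]
    by (auto simp: consistent_def mult.commute intro!: sum.cong)
  moreover have "(\<Sum>k\<in>S1. p k * \<alpha> k) = (\<Sum>k\<in>P. p k * \<alpha> k)"
    using p_out finite_P S1_sub by (intro sum.mono_neutral_left) auto
  moreover have "(\<Sum>k\<in>S2. q k * \<beta> k) = (\<Sum>k\<in>P. q k * \<beta> k)"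
    using q_out finite_P S2_sub by (intro sum.mono_neutral_left) auto
  ultimately show ?thesis by (simp add: distrib_left sum.distrib)
qed

text \<open>
  For a product \<open>k\<close> in both past assortments, \<open>y - hinge (y - r k)\<close> and \<open>z - y - hinge (x - r k)\<close>
  are the largest potentials compatible with the constraints that involve \<open>k\<close> and another
  product. The excess is the amount, if any, by which their sum surpasses the revenue \<open>r k\<close>. It has
  to be given up on one side, and this is cheaper on the side with the smaller sales.
\<close>

definition excess :: "real \<Rightarrow> real \<Rightarrow> real \<Rightarrow> nat \<Rightarrow> real" where
  "excess x y z k = hinge (z - r k) - hinge (x - r k) - hinge (y - r k)"

text \<open>
  For \<open>k\<close> only in \<open>S1\<close>, the potential rises from \<open>x + y - z\<close> (for \<open>r k \<le> x\<close>) with slope 1 in \<open>r k\<close>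
  to its maximum \<open>y\<close> (for \<open>r k \<ge> z\<close>); \<open>potential2\<close> similarly rises from 0 to \<open>z - y\<close>.
\<close>

definition potential1 :: "real \<Rightarrow> real \<Rightarrow> real \<Rightarrow> nat \<Rightarrow> real" where
  "potential1 x y z k = (if k \<in> S2
     then y - hinge (y - r k) - (if p k < q k then excess x y z k else 0)
     else y - hinge (z - r k) + hinge (x - r k))"

definition potential2 :: "real \<Rightarrow> real \<Rightarrow> real \<Rightarrow> nat \<Rightarrow> real" where
  "potential2 x y z k = (if k \<in> S1
     then z - y - hinge (x - r k) - (if p k < q k then 0 else excess x y z k)
     else z - y - hinge (z - r k) + hinge (y - r k))"

lemma potential_value:
  "(\<Sum>k\<in>P. p k * potential1 x y z k + q k * potential2 x y z k) = dual_value x y z"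
proof -
  have "p k * potential1 x y z k + q k * potential2 x y z k = p k * y + q k * (z - y)
      + (coef_x k * hinge (x - r k) + coef_y k * hinge (y - r k) + coef_z k * hinge (z - r k))"
    if "k \<in> P" for k
  proof -
    consider "k \<notin> S1" | "k \<notin> S2" | "k \<in> S1" "k \<in> S2" by blast
    then show ?thesis
    proof cases
      case 1
      then have "k \<in> S2" using S12 that by auto
      then show ?thesis using 1 p_out[OF that]
        by (simp add: potential2_def coef_x_def coef_y_def coef_z_def algebra_simps)
    next
      case 2
      then have "k \<in> S1" using S12 that by auto
      then show ?thesis using 2 q_out[OF that]
        by (simp add: potential1_def coef_x_def coef_y_def coef_z_def algebra_simps)
    next
      case 3
      then show ?thesis
        by (cases "p k < q k") (simp_all add: potential1_def potential2_def excess_def coef_x_def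
          coef_y_def coef_z_def min_def algebra_simps)
    qed
  qed
  then show ?thesis by (simp add: dual_value_split[of y "z - y" z])
qed

text \<open>
  Let \<open>s\<close> be the favourite in \<open>offered x y\<close> and \<open>i\<close>, \<open>j\<close> the favourites in \<open>S1\<close> and \<open>S2\<close>. If \<open>i\<close> is
  offered and \<open>s \<in> S1\<close>, then \<open>i = s\<close>, as each is preferred to the other; likewise for \<open>j\<close>. If \<open>i\<close>
  is not offered, its revenue lies below the threshold and its potential takes the least value. If
  \<open>s\<close> is in only one past assortment, this bounds the potential from that assortment, and the other
  one is at most its maximum. If \<open>s\<close> is in both, each of \<open>i\<close> and \<open>j\<close> is \<open>s\<close> or not offered.
\<close>

lemma potential_le_revenue:
  assumes f: "feasible x y z" and \<sigma>: "\<sigma> \<in> rankings I"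
  shows "potential1 x y z (fav \<sigma> S1) + potential2 x y z (fav \<sigma> S2) \<le> r (fav \<sigma> (offered x y))"
proof -
  define i where "i = fav \<sigma> S1"
  define j where "j = fav \<sigma> S2"
  define s where "s = fav \<sigma> (offered x y)"
  have off: "offered x y \<subseteq> P" "offered x y \<noteq> {}" using f by (auto simp: offered_def feasible_def)
  have xyz: "0 \<le> x" "0 \<le> y" "x + y \<le> z" using f by (auto simp: feasible_def)
  have i: "i \<in> S1" "\<And>t. t \<in> S1 \<Longrightarrow> \<sigma> i \<le> \<sigma> t"
    using fav_in[OF S1_sub S1_ne] by (auto simp: i_def)
  have j: "j \<in> S2" "\<And>t. t \<in> S2 \<Longrightarrow> \<sigma> j \<le> \<sigma> t"
    using fav_in[OF S2_sub S2_ne] by (auto simp: j_def)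
  have s: "s \<in> offered x y" "\<And>t. t \<in> offered x y \<Longrightarrow> \<sigma> s \<le> \<sigma> t"
    using fav_in[OF off] by (auto simp: s_def)
  have P: "i \<in> P" "j \<in> P" "s \<in> P" using i j s off S1_sub S2_sub by auto
  have rs: "0 \<le> r s" "0 \<le> r i" "0 \<le> r j" using P r_nonneg by auto
  have eq: "u = v" if "u \<in> P" "v \<in> P" "\<sigma> u \<le> \<sigma> v" "\<sigma> v \<le> \<sigma> u" for u v
    using that ranking_inj[OF \<sigma>] by (meson inj_onD order_antisym)
  have iS: "i = s" if "i \<in> offered x y" "s \<in> S1"
    using eq[OF P(1,3) i(2)[OF that(2)] s(2)[OF that(1)]] .
  have jS: "j = s" if "j \<in> offered x y" "s \<in> S2"
    using eq[OF P(2,3) j(2)[OF that(2)] s(2)[OF that(1)]] .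
  have ex: "0 \<le> excess x y z k" if "k \<in> P" for k
    using xyz r_nonneg[OF that] by (simp add: excess_def hinge_def max_def)
  have le1: "potential1 x y z k \<le> y" if "k \<in> P" for k
    using xyz r_nonneg[OF that] ex[OF that] by (simp add: potential1_def hinge_def max_def)
  have le2: "potential2 x y z k \<le> z - y" if "k \<in> P" for k
    using xyz r_nonneg[OF that] ex[OF that] by (simp add: potential2_def hinge_def max_def)
  have out1: "potential1 x y z i = y - (z - x)" if "i \<notin> offered x y"
  proof -
    have "i \<notin> S2" "r i < x" using that i P by (auto simp: offered_def)
    then show ?thesis using xyz by (simp add: potential1_def hinge_def)
  qed
  have out2: "potential2 x y z j = 0" if "j \<notin> offered x y"
  proof -
    have "j \<notin> S1" "r j < y" using that j P by (auto simp: offered_def)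
    then show ?thesis using xyz by (simp add: potential2_def hinge_def)
  qed
  consider "s \<notin> S2" | "s \<notin> S1" | "s \<in> S1" "s \<in> S2" by blast
  then have "potential1 x y z i + potential2 x y z j \<le> r s"
  proof cases
    case 1
    then have sA: "s \<in> S1" "x \<le> r s" using s P S12 by (auto simp: offered_def)
    show ?thesis
    proof (cases "i \<in> offered x y")
      case True
      then have "potential1 x y z i \<le> y - (z - r s)"
        using iS sA 1 by (auto simp: potential1_def hinge_def)
      then show ?thesis using le2[OF P(2)] by simp
    next
      case False
      then show ?thesis using out1 le2[OF P(2)] sA by simp
    qed
  next
    case 2
    then have sB: "s \<in> S2" "y \<le> r s" using s P S12 by (auto simp: offered_def)
    show ?thesis
    proof (cases "j \<in> offered x y")
      case True
      then have "potential2 x y z j \<le> z - y - (z - r s)"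
        using jS sB 2 by (auto simp: potential2_def hinge_def)
      then show ?thesis using le1[OF P(1)] by simp
    next
      case False
      then show ?thesis using out2 le1[OF P(1)] sB by simp
    qed
  next
    case 3
    show ?thesis
    proof (cases "i \<in> offered x y")
      case i_in: True
      then have ieq: "i = s" using iS 3 by simp
      show ?thesis
      proof (cases "j \<in> offered x y")
        case True
        then have js: "j = s" using jS 3 by simp
        have "potential1 x y z s + potential2 x y z s = z - hinge (z - r s)"
          using 3 by (simp add: potential1_def potential2_def excess_def)
        then show ?thesis using ieq js by (simp add: hinge_def)
      next
        case False
        have "potential1 x y z i \<le> r s"
          using ieq 3 ex[OF P(3)] by (simp add: potential1_def hinge_def max_def)
        then show ?thesis using out2[OF False] by simp
      qed
    next
      case i_out: False
      show ?thesis
      proof (cases "j \<in> offered x y")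
        case True
        then have "j = s" using jS 3 by simp
        then have "potential2 x y z j \<le> z - y - (x - r s)"
          using 3 ex[OF P(3)] by (simp add: potential2_def hinge_def max_def)
        then show ?thesis using out1[OF i_out] by simp
      next
        case False
        then show ?thesis using out1[OF i_out] out2[OF False] xyz rs by simp
      qed
    qed
  qed
  then show ?thesis by (simp add: i_def j_def s_def)
qed

lemma dual_value_le_revenue:
  assumes "feasible x y z" "l \<in> consistent"
  shows "dual_value x y z \<le> expected_revenue I l (offered x y)"
proof -
  have off: "offered x y \<subseteq> P" "offered x y \<noteq> {}"
    using assms(1) by (auto simp: offered_def feasible_def)
  have "dual_value x y z = (\<Sum>\<sigma>\<in>rankings I. l \<sigma> *
      (potential1 x y z (fav \<sigma> S1) + potential2 x y z (fav \<sigma> S2)))"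
    by (simp only: consistent_sum[OF assms(2)] potential_value)
  also have "\<dots> \<le> (\<Sum>\<sigma>\<in>rankings I. l \<sigma> * r (fav \<sigma> (offered x y)))"
    using assms by (intro sum_mono mult_left_mono potential_le_revenue) (auto simp: consistent_def)
  finally show ?thesis using expected_revenue_eq[OF off] by (simp add: mult.commute)
qed

text \<open>
  Rankings of this kind, with three prescribed top places, provide all dual constraints that are
  needed to bound arbitrary potentials. The products \<open>u\<close>, \<open>v\<close>, \<open>t\<close> may coincide.
\<close>

lemma ranking_with_podium:
  assumes "u \<in> P" "v \<in> P" "t \<in> P"
  obtains \<sigma> where "\<sigma> \<in> rankings I"
    "\<And>T. T \<subseteq> P \<Longrightarrow> u \<in> T \<Longrightarrow> fav \<sigma> T = u"
    "\<And>T. T \<subseteq> P \<Longrightarrow> u \<notin> T \<Longrightarrow> v \<in> T \<Longrightarrow> fav \<sigma> T = v"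
    "\<And>T. T \<subseteq> P \<Longrightarrow> u \<notin> T \<Longrightarrow> v \<notin> T \<Longrightarrow> t \<in> T \<Longrightarrow> fav \<sigma> T = t"
proof -
  \<comment> \<open>The last update wins, so \<open>f\<close> is injective even if some of the three products are equal.\<close>
  define f :: "nat \<Rightarrow> nat" where "f = (\<lambda>k. k + 3)(t := 2, v := 1, u := 0)"
  have inj: "f a = f b \<Longrightarrow> a = b" for a b by (auto simp: f_def split: if_splits)
  define \<sigma> where "\<sigma> = restrict (\<lambda>a. card {b \<in> P. f b < f a}) P"
  have less: "\<sigma> a < \<sigma> b" if "a \<in> P" "b \<in> P" "f a < f b" for a b
  proof -
    have "{c \<in> P. f c < f a} \<subset> {c \<in> P. f c < f b}" using that by auto
    then show ?thesis using finite_P that by (simp add: \<sigma>_def psubset_card_mono)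
  qed
  have inj\<sigma>: "inj_on \<sigma> P"
  proof (rule inj_onI)
    fix a b assume "a \<in> P" "b \<in> P" "\<sigma> a = \<sigma> b"
    then show "a = b" using less[of a b] less[of b a] inj[of a b]
      by (metis less_irrefl linorder_neqE_nat)
  qed
  have "\<sigma> a \<le> num_products I" if "a \<in> P" for a
  proof -
    have "card {b \<in> P. f b < f a} \<le> card (P - {a})" using finite_P by (intro card_mono) auto
    also have "\<dots> = num_products I" using that finite_P by (simp add: P_eq)
    finally show ?thesis using that by (simp add: \<sigma>_def)
  qed
  then have "\<sigma> ` P \<subseteq> {0..num_products I}" by auto
  moreover have "card (\<sigma> ` P) = card {0..num_products I}"
    using inj\<sigma> by (simp add: card_image P_eq)
  ultimately have "\<sigma> ` P = {0..num_products I}" by (intro card_subset_eq) auto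
  then have \<sigma>: "\<sigma> \<in> rankings I"
    using inj\<sigma> by (auto simp: rankings_def bij_betw_def \<sigma>_def)
  have best: "fav \<sigma> T = a" if "T \<subseteq> P" "a \<in> T" "\<And>b. b \<in> T \<Longrightarrow> f a \<le> f b" for T a
  proof (rule fav_eqI[OF \<sigma> that(1,2)])
    fix b assume "b \<in> T"
    then show "\<sigma> a \<le> \<sigma> b" using less[of a b] that inj[of a b]
      by (metis le_neq_implies_less less_imp_le order_refl subsetD)
  qed
  show ?thesis
  proof (rule that[OF \<sigma>])
    show "fav \<sigma> T = u" if "T \<subseteq> P" "u \<in> T" for T
      using that by (intro best) (auto simp: f_def)
    show "fav \<sigma> T = v" if "T \<subseteq> P" "u \<notin> T" "v \<in> T" for T
      using that by (intro best) (auto simp: f_def)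
    show "fav \<sigma> T = t" if "T \<subseteq> P" "u \<notin> T" "v \<notin> T" "t \<in> T" for T
      using that by (intro best) (auto simp: f_def)
  qed
qed

lemma dual_value_zero: "dual_value 0 0 0 = 0"
  using r_nonneg by (simp add: dual_value_def hinge_def)

lemma feasible_zero: "feasible 0 0 0"
  using zero_P r_zero by (simp add: feasible_def offered_def)

text \<open>
  With \<open>a\<close> and \<open>b\<close> the largest values of \<open>\<alpha>\<close> on \<open>S1\<close> and \<open>\<beta>\<close> on \<open>S2\<close>, the witnesses are \<open>z = a + b\<close>
  and the thresholds \<open>x\<close>, \<open>y\<close> described at the top. An offered product \<open>i\<close> of
  \<open>S1 - S2\<close> can be ranked before a product where \<open>\<beta>\<close> attains \<open>b\<close>, so \<open>\<alpha> i \<le> r i - b\<close>; an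
  unoffered one satisfies \<open>\<alpha> i \<le> x - b\<close> by definition of \<open>x\<close>. Unoffered products \<open>i\<close> of \<open>S1 - S2\<close>
  and \<open>j\<close> of \<open>S2 - S1\<close>, followed by the no-purchase option, have \<open>\<alpha> i + \<beta> j \<le> 0\<close>, which gives
  \<open>x + y \<le> z\<close>; followed by a common product \<open>c\<close>, \<open>i\<close> bounds \<open>\<beta> c\<close> and \<open>j\<close> bounds \<open>\<alpha> c\<close>. If the
  no-purchase option is not in \<open>S2\<close>, placing it right after an unoffered \<open>i\<close> shows
  \<open>\<alpha> i + b \<le> 0\<close> and hence \<open>x = 0\<close>.
\<close>

lemma potentials_dominated:
  assumes S: "S \<in> assortments I"
    and pot: "\<And>\<sigma>. \<sigma> \<in> rankings I \<Longrightarrow> \<alpha> (fav \<sigma> S1) + \<beta> (fav \<sigma> S2) \<le> r (fav \<sigma> S)"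
  obtains x y z where "feasible x y z" "(\<Sum>k\<in>P. p k * \<alpha> k + q k * \<beta> k) \<le> dual_value x y z"
proof -
  have SP: "S \<subseteq> P" "0 \<in> S" using S by (auto simp: assortments_def)
  note fin = finite_S1 finite_S2
  define a where "a = Max (\<alpha> ` S1)"
  define b where "b = Max (\<beta> ` S2)"
  have a: "\<alpha> k \<le> a" if "k \<in> S1" for k using that fin by (auto simp: a_def)
  have b: "\<beta> k \<le> b" if "k \<in> S2" for k using that fin by (auto simp: b_def)
  have "a \<in> \<alpha> ` S1" "b \<in> \<beta> ` S2" unfolding a_def b_def using fin S1_ne S2_ne by (auto intro!: Max_in)
  then obtain u v where u: "u \<in> S1" "\<alpha> u = a" and v: "v \<in> S2" "\<beta> v = b" by blast
  \<comment> \<open>The dual constraint of the ranking that starts with \<open>i\<close>, \<open>j\<close>, \<open>t\<close>.\<close>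
  have podium: "\<alpha> (if i \<in> S1 then i else if j \<in> S1 then j else t)
      + \<beta> (if i \<in> S2 then i else if j \<in> S2 then j else t)
      \<le> r (if i \<in> S then i else if j \<in> S then j else t)"
    if P: "i \<in> P" "j \<in> P" "t \<in> P" and any: "i \<in> S1 \<or> j \<in> S1 \<or> t \<in> S1"
      "i \<in> S2 \<or> j \<in> S2 \<or> t \<in> S2" "i \<in> S \<or> j \<in> S \<or> t \<in> S" for i j t
  proof -
    obtain \<sigma> where \<sigma>: "\<sigma> \<in> rankings I"
      "\<And>T. T \<subseteq> P \<Longrightarrow> i \<in> T \<Longrightarrow> fav \<sigma> T = i"
      "\<And>T. T \<subseteq> P \<Longrightarrow> i \<notin> T \<Longrightarrow> j \<in> T \<Longrightarrow> fav \<sigma> T = j"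
      "\<And>T. T \<subseteq> P \<Longrightarrow> i \<notin> T \<Longrightarrow> j \<notin> T \<Longrightarrow> t \<in> T \<Longrightarrow> fav \<sigma> T = t"
      using ranking_with_podium[OF P] by blast
    have fav: "fav \<sigma> T = (if i \<in> T then i else if j \<in> T then j else t)"
      if "T \<subseteq> P" "i \<in> T \<or> j \<in> T \<or> t \<in> T" for T using that \<sigma>(2-4) by auto
    show ?thesis
      using pot[OF \<sigma>(1)] unfolding fav[OF S1_sub any(1)] fav[OF S2_sub any(2)] fav[OF SP(1) any(3)] .
  qed
  have uP: "u \<in> P" and vP: "v \<in> P" using u v S1_sub S2_sub by auto
  have inP: "\<And>k. k \<in> S1 \<Longrightarrow> k \<in> P" "\<And>k. k \<in> S2 \<Longrightarrow> k \<in> P"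
    using S1_sub S2_sub by auto
  have in1: "\<alpha> i + b \<le> r i" if "i \<in> S1" "i \<notin> S2" "i \<in> S" for i
    using podium[of i v i] that v vP inP by auto
  have in2: "a + \<beta> j \<le> r j" if "j \<in> S2" "j \<notin> S1" "j \<in> S" for j
    using podium[of j u j] that u uP inP by auto
  have out: "\<alpha> i + \<beta> j \<le> 0" if "i \<in> S1" "i \<notin> S2" "i \<notin> S" "j \<in> S2" "j \<notin> S1" "j \<notin> S" for i j
    using podium[of i j 0] that SP inP zero_P r_zero by auto
  have le_c: "t \<le> r c" if "t \<le> r (if c \<in> S then c else 0)" "c \<in> P" for t c
    using that r_nonneg[of c] r_zero by (cases "c \<in> S") auto
  have out1: "\<alpha> i + \<beta> c \<le> r c" if "i \<in> S1" "i \<notin> S2" "i \<notin> S" "c \<in> S1" "c \<in> S2" for i c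
    by (rule le_c) (use podium[of i c 0] that SP inP zero_P in auto)
  have out2: "\<alpha> c + \<beta> j \<le> r c" if "j \<in> S2" "j \<notin> S1" "j \<notin> S" "c \<in> S1" "c \<in> S2" for j c
    by (rule le_c) (use podium[of j c 0] that SP inP zero_P in auto)
  have both: "\<alpha> c + \<beta> c \<le> r c" if "c \<in> S1" "c \<in> S2" for c
    by (rule le_c) (use podium[of c 0 0] that SP inP zero_P in auto)
  have pin1: "\<alpha> i + b \<le> 0" if "0 \<notin> S2" "i \<in> S1" "i \<notin> S2" "i \<notin> S" for i
    using podium[of i 0 v] that v vP SP inP zero_P r_zero by auto
  have pin2: "a + \<beta> j \<le> 0" if "0 \<notin> S1" "j \<in> S2" "j \<notin> S1" "j \<notin> S" for j
    using podium[of j 0 u] that u uP SP inP zero_P r_zero by auto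
  \<comment> \<open>For \<open>z < 0\<close> the dual objective is negative, and the point \<open>(0, 0, 0)\<close> has value 0.\<close>
  define z where "z = a + b"
  show ?thesis
  proof (cases "z < 0")
    case True
    have "(\<Sum>k\<in>P. p k * \<alpha> k + q k * \<beta> k) \<le> (\<Sum>k\<in>P. p k * a + q k * b)"
    proof (intro sum_mono add_mono)
      fix k assume "k \<in> P"
      then show "p k * \<alpha> k \<le> p k * a"
        using a p_nonneg p_out by (cases "k \<in> S1") (auto intro: mult_left_mono)
      show "q k * \<beta> k \<le> q k * b"
        using \<open>k \<in> P\<close> b q_nonneg q_out by (cases "k \<in> S2") (auto intro: mult_left_mono)
    qed
    also have "\<dots> = a + b" using p_sum q_sum by (simp add: sum.distrib sum_distrib_right[symmetric])
    finally show ?thesis using that[OF feasible_zero] True dual_value_zero by (simp add: z_def)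
  next
    case False
    define X where "X = insert 0 ((\<lambda>i. \<alpha> i + b) ` (S1 - S2 - S))"
    define Y where "Y = insert 0 ((\<lambda>j. a + \<beta> j) ` (S2 - S1 - S))"
    define x where "x = Max X"
    define y where "y = Max Y"
    have finXY: "finite X" "finite Y" "X \<noteq> {}" "Y \<noteq> {}" using fin by (auto simp: X_def Y_def)
    have xX: "x \<in> X" "y \<in> Y" unfolding x_def y_def using finXY by (auto intro: Max_in)
    have x_ge: "t \<le> x" if "t \<in> X" for t using that finXY by (simp add: x_def)
    have y_ge: "t \<le> y" if "t \<in> Y" for t using that finXY by (simp add: y_def)
    have x0: "0 \<le> x" and y0: "0 \<le> y" using x_ge y_ge by (auto simp: X_def Y_def)
    have xc: "x = 0 \<or> (\<exists>i. i \<in> S1 \<and> i \<notin> S2 \<and> i \<notin> S \<and> x = \<alpha> i + b)"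
      using xX by (auto simp: X_def)
    have yc: "y = 0 \<or> (\<exists>j. j \<in> S2 \<and> j \<notin> S1 \<and> j \<notin> S \<and> y = a + \<beta> j)"
      using xX by (auto simp: Y_def)
    have xyz: "x + y \<le> z"
      using xc yc False a b out by (auto simp: z_def)
    have pinx: "x = 0" if "0 \<notin> S2" using xc pin1[OF that] x0 by force
    have piny: "y = 0" if "0 \<notin> S1" using yc pin2[OF that] y0 by force
    have feas: "feasible x y z"
      using x0 y0 xyz pinx piny zero_P r_zero by (auto simp: feasible_def offered_def)
    have "(\<Sum>k\<in>P. p k * \<alpha> k + q k * \<beta> k) \<le> dual_value x y z"
      unfolding dual_value_split[OF z_def[symmetric]]
    proof (rule sum_mono)
      fix k assume k: "k \<in> P"
      consider "k \<notin> S2" | "k \<notin> S1" | "k \<in> S1" "k \<in> S2" by blast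
      then show "p k * \<alpha> k + q k * \<beta> k \<le> p k * a + q k * b + (coef_x k * hinge (x - r k)
          + coef_y k * hinge (y - r k) + coef_z k * hinge (z - r k))"
      proof cases
        case 1
        then have k1: "k \<in> S1" using k S12 by auto
        have "\<alpha> k \<le> a + hinge (x - r k) - hinge (z - r k)"
        proof (cases "k \<in> S")
          case True
          then show ?thesis using in1[OF k1 1 True] a[OF k1] by (auto simp: hinge_def z_def)
        next
          case False
          then have "\<alpha> k + b \<le> x" using k1 1 x_ge by (auto simp: X_def)
          then show ?thesis using a[OF k1] by (auto simp: hinge_def z_def)
        qed
        then have "p k * \<alpha> k \<le> p k * (a + hinge (x - r k) - hinge (z - r k))"
          using p_nonneg[OF k] by (intro mult_left_mono) auto
        then show ?thesis using 1 k1 q_out[OF k]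
          by (simp add: coef_x_def coef_y_def coef_z_def algebra_simps)
      next
        case 2
        then have k2: "k \<in> S2" using k S12 by auto
        have "\<beta> k \<le> b + hinge (y - r k) - hinge (z - r k)"
        proof (cases "k \<in> S")
          case True
          then show ?thesis using in2[OF k2 2 True] b[OF k2] by (auto simp: hinge_def z_def)
        next
          case False
          then have "a + \<beta> k \<le> y" using k2 2 y_ge by (auto simp: Y_def)
          then show ?thesis using b[OF k2] by (auto simp: hinge_def z_def)
        qed
        then have "q k * \<beta> k \<le> q k * (b + hinge (y - r k) - hinge (z - r k))"
          using q_nonneg[OF k] by (intro mult_left_mono) auto
        then show ?thesis using 2 k2 p_out[OF k]
          by (simp add: coef_x_def coef_y_def coef_z_def algebra_simps)
      next
        case 3
        have "\<alpha> k \<le> r k - (y - a)" if "0 < y" using yc out2[OF _ _ _ 3] that by force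
        then have A: "\<alpha> k \<le> a - hinge (y - r k)"
          using a[OF 3(1)] r_nonneg[OF k] by (cases "0 < y") (auto simp: hinge_def)
        have "\<beta> k \<le> r k - (x - b)" if "0 < x" using xc out1[OF _ _ _ 3] that by force
        then have B: "\<beta> k \<le> b - hinge (x - r k)"
          using b[OF 3(2)] r_nonneg[OF k] by (cases "0 < x") (auto simp: hinge_def)
        define d where "d = hinge (z - r k) - hinge (x - r k) - hinge (y - r k)"
        have D: "\<alpha> k + \<beta> k \<le> (a - hinge (y - r k)) + (b - hinge (x - r k)) - d"
          using both[OF 3] a[OF 3(1)] b[OF 3(2)] by (simp add: d_def hinge_def z_def)
        \<comment> \<open>The smaller of the two weights is put on the sum of the potentials and the rest on the
          potential with the larger weight.\<close>
        have "p k * \<alpha> k + q k * \<beta> k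
            \<le> p k * (a - hinge (y - r k)) + q k * (b - hinge (x - r k)) - min (p k) (q k) * d"
        proof (cases "p k \<le> q k")
          case True
          have "p k * (\<alpha> k + \<beta> k) \<le> p k * ((a - hinge (y - r k)) + (b - hinge (x - r k)) - d)"
            using D p_nonneg[OF k] by (rule mult_left_mono)
          moreover have "(q k - p k) * \<beta> k \<le> (q k - p k) * (b - hinge (x - r k))"
            using B True by (intro mult_left_mono) auto
          ultimately show ?thesis using True by (simp add: algebra_simps)
        next
          case False
          have "q k * (\<alpha> k + \<beta> k) \<le> q k * ((a - hinge (y - r k)) + (b - hinge (x - r k)) - d)"
            using D q_nonneg[OF k] by (rule mult_left_mono)
          moreover have "(p k - q k) * \<alpha> k \<le> (p k - q k) * (a - hinge (y - r k))"
            using A False by (intro mult_left_mono) auto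
          ultimately show ?thesis using False by (simp add: algebra_simps)
        qed
        then show ?thesis using 3
          by (simp add: coef_x_def coef_y_def coef_z_def d_def algebra_simps)
      qed
    qed
    then show ?thesis using that[OF feas] by blast
  qed
qed

text \<open>
  Strong duality for the linear program of the adversary. It is feasible by assumption and bounded
  because revenues are nonnegative, which makes the zero potentials dual feasible.
\<close>

lemma worst_case_attained:
  assumes S: "S \<in> assortments I" and ne: "consistent \<noteq> {}"
  obtains v x y z where "has_minimum (\<lambda>l. expected_revenue I l S) consistent v"
    "feasible x y z" "v \<le> dual_value x y z"
proof -
  obtain l0 where l0: "l0 \<in> consistent" using ne by blast
  have SP: "S \<subseteq> P" "S \<noteq> {}" using S by (auto simp: assortments_def)
  define Y where "Y = Sigma {1, 2} (past I)"
  define A where "A = (\<lambda>(m, i) (\<sigma> :: nat \<Rightarrow> nat). of_bool (i = fav \<sigma> (past I m)) :: real)"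
  define d where "d = (\<lambda>(m, i). sales I m i)"
  note fin = finite_S1 finite_S2
  then have finY: "finite Y" by (auto simp: Y_def S1_def S2_def)
  have sumY: "(\<Sum>y\<in>Y. f y) = (\<Sum>i\<in>S1. f (1, i)) + (\<Sum>i\<in>S2. f (2, i))"
    for f :: "nat \<times> nat \<Rightarrow> real"
  proof -
    have "Y = Pair 1 ` S1 \<union> Pair 2 ` S2" by (auto simp: Y_def S1_def S2_def)
    moreover have "Pair (1 :: nat) ` S1 \<inter> Pair 2 ` S2 = {}" by auto
    ultimately show ?thesis using fin by (simp add: sum.union_disjoint sum.reindex inj_on_def)
  qed
  have dual_sum: "(\<Sum>y\<in>Y. A y \<sigma> * u y) = u (1, fav \<sigma> S1) + u (2, fav \<sigma> S2)"
    for \<sigma> :: "nat \<Rightarrow> nat" and u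
    unfolding sumY using fin fav_in(1)[OF S1_sub S1_ne, of \<sigma>] fav_in(1)[OF S2_sub S2_ne, of \<sigma>]
    by (simp add: A_def S1_def[symmetric] S2_def[symmetric] del: One_nat_def)
  have cons: "l \<in> consistent \<longleftrightarrow> (\<forall>\<sigma>\<in>rankings I. 0 \<le> l \<sigma>) \<and>
      (\<forall>y\<in>Y. (\<Sum>\<sigma>\<in>rankings I. A y \<sigma> * l \<sigma>) = d y)" for l
    by (auto simp: consistent_def Y_def A_def d_def choice_prob_def S1_def S2_def p_def q_def)
  obtain l u where l: "\<And>\<sigma>. \<sigma> \<in> rankings I \<Longrightarrow> 0 \<le> l \<sigma>"
      "\<And>y. y \<in> Y \<Longrightarrow> (\<Sum>\<sigma>\<in>rankings I. A y \<sigma> * l \<sigma>) = d y"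
    and u: "\<And>\<sigma>. \<sigma> \<in> rankings I \<Longrightarrow> (\<Sum>y\<in>Y. A y \<sigma> * u y) \<le> r (fav \<sigma> S)"
    and opt: "(\<Sum>\<sigma>\<in>rankings I. r (fav \<sigma> S) * l \<sigma>) \<le> (\<Sum>y\<in>Y. d y * u y)"
  proof (rule lp_strong_duality[OF finite_rankings finY])
    show "0 \<le> l0 \<sigma>" if "\<sigma> \<in> rankings I" for \<sigma> using l0 that by (auto simp: cons)
    show "(\<Sum>\<sigma>\<in>rankings I. A y \<sigma> * l0 \<sigma>) = d y" if "y \<in> Y" for y using l0 that by (auto simp: cons)
    show "(\<Sum>y\<in>Y. A y \<sigma> * (0::real)) \<le> r (fav \<sigma> S)" for \<sigma>
      using fav_in(1)[OF SP, of \<sigma>] SP r_nonneg by auto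
  qed blast
  define v where "v = expected_revenue I l S"
  have lc: "l \<in> consistent" using l by (auto simp: cons)
  have "v \<le> expected_revenue I l' S" if "l' \<in> consistent" for l'
  proof -
    have "(\<Sum>y\<in>Y. d y * u y) \<le> (\<Sum>\<sigma>\<in>rankings I. r (fav \<sigma> S) * l' \<sigma>)"
      using that u by (intro lp_weak_duality) (auto simp: cons)
    then show ?thesis using opt by (simp add: v_def expected_revenue_eq[OF SP])
  qed
  then have min: "has_minimum (\<lambda>l. expected_revenue I l S) consistent v"
    using lc by (auto simp: has_minimum_def v_def)
  obtain x y z where xyz: "feasible x y z"
    "(\<Sum>k\<in>P. p k * u (1, k) + q k * u (2, k)) \<le> dual_value x y z"
    using potentials_dominated[OF S, of "\<lambda>k. u (1, k)" "\<lambda>k. u (2, k)"] u dual_sum by auto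
  have "(\<Sum>y\<in>Y. d y * u y) = (\<Sum>\<sigma>\<in>rankings I. l \<sigma> * (\<Sum>y\<in>Y. A y \<sigma> * u y))"
  proof -
    have "(\<Sum>y\<in>Y. d y * u y) = (\<Sum>y\<in>Y. u y * (\<Sum>\<sigma>\<in>rankings I. A y \<sigma> * l \<sigma>))"
      using l(2) by (intro sum.cong) auto
    also have "\<dots> = (\<Sum>\<sigma>\<in>rankings I. (\<Sum>y\<in>Y. A y \<sigma> * u y) * l \<sigma>)"
      by (rule bilinear_swap[symmetric])
    finally show ?thesis by (simp add: mult.commute)
  qed
  also have "\<dots> = (\<Sum>k\<in>P. p k * u (1, k) + q k * u (2, k))"
    unfolding dual_sum using consistent_sum[OF lc, of "\<lambda>k. u (1, k)" "\<lambda>k. u (2, k)"] .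
  finally have "v \<le> dual_value x y z"
    using opt xyz(2) by (simp add: v_def expected_revenue_eq[OF SP])
  then show ?thesis using that min xyz(1) by blast
qed

end

section \<open>Rounding to breakpoints\<close>

definition affine_between :: "real set \<Rightarrow> (real \<Rightarrow> real) \<Rightarrow> bool" where
  "affine_between D \<phi> \<longleftrightarrow>
     (\<forall>u v. u < v \<longrightarrow> D \<inter> {u<..<v} = {} \<longrightarrow> (\<exists>a b. \<forall>t\<in>{u..v}. \<phi> t = a * t + b))"

lemma affine_between_mono: "affine_between D \<phi> \<Longrightarrow> D \<subseteq> D' \<Longrightarrow> affine_between D' \<phi>"
  unfolding affine_between_def by (meson disjoint_iff subsetD)

lemma affine_between_affine: "affine_between D (\<lambda>t. a * t + b)"
  unfolding affine_between_def by blast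

lemma affine_between_add:
  assumes "affine_between D \<phi>" "affine_between D \<psi>"
  shows "affine_between D (\<lambda>t. \<phi> t + \<psi> t)"
  unfolding affine_between_def
proof (intro allI impI)
  fix u v :: real assume uv: "u < v" "D \<inter> {u<..<v} = {}"
  from assms[unfolded affine_between_def, rule_format, OF uv]
  obtain a b a' b' where "\<forall>t\<in>{u..v}. \<phi> t = a * t + b" "\<forall>t\<in>{u..v}. \<psi> t = a' * t + b'" by blast
  then have "\<forall>t\<in>{u..v}. \<phi> t + \<psi> t = (a + a') * t + (b + b')" by (simp add: algebra_simps)
  then show "\<exists>a b. \<forall>t\<in>{u..v}. \<phi> t + \<psi> t = a * t + b" by blast
qed

lemma affine_between_cmult:
  assumes "affine_between D \<phi>"
  shows "affine_between D (\<lambda>t. c * \<phi> t)"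
  unfolding affine_between_def
proof (intro allI impI)
  fix u v :: real assume uv: "u < v" "D \<inter> {u<..<v} = {}"
  from assms[unfolded affine_between_def, rule_format, OF uv]
  obtain a b where "\<forall>t\<in>{u..v}. \<phi> t = a * t + b" by blast
  then have "\<forall>t\<in>{u..v}. c * \<phi> t = (c * a) * t + c * b" by (simp add: algebra_simps)
  then show "\<exists>a b. \<forall>t\<in>{u..v}. c * \<phi> t = a * t + b" by blast
qed

lemma affine_between_sum:
  assumes "\<And>k. k \<in> K \<Longrightarrow> affine_between D (\<phi> k)"
  shows "affine_between D (\<lambda>t. \<Sum>k\<in>K. \<phi> k t)"
  using assms
proof (induction K rule: infinite_finite_induct)
  case (insert k K)
  then show ?case by (simp add: affine_between_add)
qed (use affine_between_affine[of D 0 0] in auto)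

lemma affine_between_hinge: "d \<in> D \<Longrightarrow> affine_between D (\<lambda>t. max 0 (t - d))"
  unfolding affine_between_def
proof (intro allI impI)
  fix u v :: real assume uv: "u < v" "D \<inter> {u<..<v} = {}" and "d \<in> D"
  then have "d \<notin> {u<..<v}" by blast
  then consider "d \<le> u" | "v \<le> d" by fastforce
  then show "\<exists>a b. \<forall>t\<in>{u..v}. max 0 (t - d) = a * t + b"
  proof cases
    case 1
    then have "\<forall>t\<in>{u..v}. max 0 (t - d) = 1 * t + - d" by auto
    then show ?thesis by blast
  next
    case 2
    then have "\<forall>t\<in>{u..v}. max 0 (t - d) = 0 * t + 0" by auto
    then show ?thesis by blast
  qed
qed

lemma affine_between_shift:
  assumes "affine_between D \<phi>"
  shows "affine_between ((\<lambda>d. d - c) ` D) (\<lambda>t. \<phi> (t + c))"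
  unfolding affine_between_def
proof (intro allI impI)
  fix u v :: real assume uv: "u < v" "(\<lambda>d. d - c) ` D \<inter> {u<..<v} = {}"
  then have "u + c < v + c" "D \<inter> {u + c<..<v + c} = {}" by force+
  from assms[unfolded affine_between_def, rule_format, OF this]
  obtain a b where ab: "\<forall>t\<in>{u + c..v + c}. \<phi> t = a * t + b" by blast
  have "\<forall>t\<in>{u..v}. \<phi> (t + c) = a * t + (a * c + b)"
  proof
    fix t assume "t \<in> {u..v}"
    then have "t + c \<in> {u + c..v + c}" by simp
    with ab have "\<phi> (t + c) = a * (t + c) + b" by blast
    then show "\<phi> (t + c) = a * t + (a * c + b)" by (simp add: algebra_simps)
  qed
  then show "\<exists>a b. \<forall>t\<in>{u..v}. \<phi> (t + c) = a * t + b" by blast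
qed

lemma affine_between_reflect:
  assumes "affine_between D \<phi>"
  shows "affine_between ((\<lambda>d. c - d) ` D) (\<lambda>t. \<phi> (c - t))"
  unfolding affine_between_def
proof (intro allI impI)
  fix u v :: real assume uv: "u < v" "(\<lambda>d. c - d) ` D \<inter> {u<..<v} = {}"
  then have "c - v < c - u" "D \<inter> {c - v<..<c - u} = {}" by force+
  from assms[unfolded affine_between_def, rule_format, OF this]
  obtain a b where ab: "\<forall>t\<in>{c - v..c - u}. \<phi> t = a * t + b" by blast
  have "\<forall>t\<in>{u..v}. \<phi> (c - t) = (- a) * t + (a * c + b)"
  proof
    fix t assume "t \<in> {u..v}"
    then have "c - t \<in> {c - v..c - u}" by simp
    with ab have "\<phi> (c - t) = a * (c - t) + b" by blast
    then show "\<phi> (c - t) = (- a) * t + (a * c + b)" by (simp add: algebra_simps)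
  qed
  then show "\<exists>a b. \<forall>t\<in>{u..v}. \<phi> (c - t) = a * t + b" by blast
qed

text \<open>
  On the piece between the breakpoints next to \<open>t\<close> the function is affine, so one of the two ends of
  the piece is at least as good as \<open>t\<close>.
\<close>

lemma round_in_interval:
  assumes "finite D" "affine_between D \<phi>" "l \<le> t" "t \<le> u"
  obtains t' where "l \<le> t'" "t' \<le> u" "t' \<in> D \<or> t' = l \<or> t' = u" "\<phi> t \<le> \<phi> t'"
proof -
  define A where "A = {d \<in> insert l D. l \<le> d \<and> d \<le> t}"
  define B where "B = {d \<in> insert u D. t \<le> d \<and> d \<le> u}"
  have fin: "finite A" "finite B" "l \<in> A" "u \<in> B" using assms by (auto simp: A_def B_def)
  have lo: "Max A \<in> A" and hi: "Min B \<in> B" using fin by (auto intro: Max_in Min_in)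
  have "D \<inter> {Max A<..<Min B} = {}"
  proof (rule ccontr)
    assume "D \<inter> {Max A<..<Min B} \<noteq> {}"
    then obtain d where d: "d \<in> D" "Max A < d" "d < Min B" by auto
    have "d \<notin> A" "d \<notin> B" using d fin by (meson Max_ge not_less, meson Min_le not_less)
    moreover have "l \<le> d" "d \<le> u" using d lo hi by (auto simp: A_def B_def)
    ultimately show False using d by (auto simp: A_def B_def)
  qed
  show ?thesis
  proof (cases "Max A < Min B")
    case True
    from assms(2)[unfolded affine_between_def, rule_format, OF True \<open>D \<inter> _ = {}\<close>]
    obtain a b where ab: "\<And>s. Max A \<le> s \<Longrightarrow> s \<le> Min B \<Longrightarrow> \<phi> s = a * s + b" by auto
    have t: "Max A \<le> t" "t \<le> Min B" using lo hi by (auto simp: A_def B_def)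
    show ?thesis
    proof (cases "0 \<le> a")
      case True
      then have "\<phi> t \<le> \<phi> (Min B)" using ab t by (simp add: mult_left_mono)
      then show ?thesis using that[of "Min B"] hi t assms by (auto simp: B_def)
    next
      case False
      then have "\<phi> t \<le> \<phi> (Max A)" using ab t by (simp add: mult_left_mono_neg)
      then show ?thesis using that[of "Max A"] lo t assms by (auto simp: A_def)
    qed
  next
    case False
    then have "t = Max A" using lo hi by (auto simp: A_def B_def)
    then show ?thesis using that[of t] lo assms by (auto simp: A_def)
  qed
qed

text \<open>
  Beyond the last breakpoint the function is affine and bounded above, hence nonincreasing.
\<close>

lemma round_on_ray:
  assumes "finite D" "affine_between D \<phi>" "l \<le> t" and bound: "\<And>s. l \<le> s \<Longrightarrow> \<phi> s \<le> B"
  obtains t' where "l \<le> t'" "t' \<in> D \<or> t' = l" "\<phi> t \<le> \<phi> t'"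
proof (cases "\<exists>d\<in>D. t \<le> d")
  case True
  then obtain d where d: "d \<in> D" "t \<le> d" by blast
  from round_in_interval[OF assms(1-3) d(2)] d(1) show ?thesis using that by metis
next
  case False
  define A where "A = {d \<in> insert l D. l \<le> d}"
  have fin: "finite A" "l \<in> A" using assms(1) by (auto simp: A_def)
  have lo: "Max A \<in> A" using fin by (auto intro: Max_in)
  have le: "Max A \<le> t" using lo False assms(3) by (auto simp: A_def)
  have beyond: "D \<inter> {Max A<..<v} = {}" for v
  proof (rule ccontr)
    assume "D \<inter> {Max A<..<v} \<noteq> {}"
    then obtain d where d: "d \<in> D" "Max A < d" by auto
    then have "d \<notin> A" using fin by (meson Max_ge not_less)
    then show False using d lo by (auto simp: A_def)
  qed
  have "\<phi> t \<le> \<phi> (Max A)"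
  proof (rule ccontr)
    assume gt: "\<not> \<phi> t \<le> \<phi> (Max A)"
    then have lt: "Max A < t" using le by (cases "Max A = t") auto
    define piece where "piece v a b \<longleftrightarrow> (\<forall>s\<in>{Max A..v}. \<phi> s = a * s + b)" for v a b
    have ex: "\<exists>a b. piece v a b" if "Max A < v" for v
      using assms(2)[unfolded affine_between_def, rule_format, OF that beyond]
      by (simp add: piece_def)
    obtain a b where ab: "piece t a b" using ex[OF lt] by blast
    have "a * (t - Max A) > 0" using ab gt lt by (simp add: piece_def algebra_simps)
    then have "a > 0" using lt by (simp add: zero_less_mult_iff)
    define v where "v = max t ((B + 1 - b) / a)"
    have "Max A < v" using lt by (simp add: v_def)
    then obtain a' b' where ab': "piece v a' b'" using ex by blast
    have "a' * t + b' = a * t + b" "a' * Max A + b' = a * Max A + b"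
      using ab ab' lt unfolding piece_def v_def
      by (metis atLeastAtMost_iff le_max_iff_disj less_imp_le order_refl)+
    then have "(a' - a) * (t - Max A) = 0" by (simp add: algebra_simps)
    then have "a' = a" using lt by simp
    with \<open>a' * t + b' = a * t + b\<close> have "b' = b" by simp
    have "\<phi> v = a * v + b" using ab' \<open>a' = a\<close> \<open>b' = b\<close> \<open>Max A < v\<close> by (auto simp: piece_def)
    moreover have "a * v \<ge> B + 1 - b"
      using \<open>a > 0\<close> by (simp add: v_def field_simps max_def)
    moreover have "\<phi> v \<le> B" using lo \<open>Max A < v\<close> by (intro bound) (auto simp: A_def)
    ultimately show False by simp
  qed
  then show ?thesis using that[of "Max A"] lo by (auto simp: A_def)
qed

text \<open>
  Maximization of \<open>f x + g y + h z\<close> over \<open>0 \<le> x\<close>, \<open>0 \<le> y\<close>, \<open>x + y \<le> z\<close>. The flags \<open>pin_x\<close> and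
  \<open>pin_y\<close> force a coordinate to be 0, which happens when the no-purchase option occurs in only one
  of the two past assortments.
\<close>

locale separable_maximization =
  fixes R :: "real set" and f g h :: "real \<Rightarrow> real" and pin_x pin_y :: bool and B :: real
  assumes fin: "finite R" and zero: "0 \<in> R"
    and aff: "affine_between R f" "affine_between R g" "affine_between R h"
    and bounded: "\<And>x y z. 0 \<le> x \<Longrightarrow> 0 \<le> y \<Longrightarrow> x + y \<le> z \<Longrightarrow> (pin_x \<longrightarrow> x = 0) \<Longrightarrow>
      (pin_y \<longrightarrow> y = 0) \<Longrightarrow> f x + g y + h z \<le> B"
begin

definition region :: "real \<Rightarrow> real \<Rightarrow> real \<Rightarrow> bool" where
  "region x y z \<longleftrightarrow> 0 \<le> x \<and> 0 \<le> y \<and> x + y \<le> z \<and> (pin_x \<longrightarrow> x = 0) \<and> (pin_y \<longrightarrow> y = 0)"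

definition vertex :: "real \<Rightarrow> real \<Rightarrow> real \<Rightarrow> bool" where
  "vertex x y z \<longleftrightarrow> x \<in> R \<and> y \<in> R \<and> (z \<in> R \<or> z = x + y) \<or>
     x \<in> R \<and> z \<in> R \<and> y = z - x \<or> y \<in> R \<and> z \<in> R \<and> x = z - y"

definition dominated :: "real \<Rightarrow> real \<Rightarrow> real \<Rightarrow> bool" where
  "dominated x y z \<longleftrightarrow>
     (\<exists>x' y' z'. region x' y' z' \<and> vertex x' y' z' \<and> f x + g y + h z \<le> f x' + g y' + h z')"

lemma dominated_step:
  "dominated x' y' z' \<Longrightarrow> f x + g y + h z \<le> f x' + g y' + h z' \<Longrightarrow> dominated x y z"
  unfolding dominated_def by (meson order_trans)

lemma dominated_fixed_xy:
  assumes "region x y z" "x \<in> R" "y \<in> R"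
  shows "dominated x y z"
proof -
  have bound: "h s \<le> B - f x - g y" if "x + y \<le> s" for s
  proof -
    have "f x + g y + h s \<le> B" using assms(1) that unfolding region_def by (intro bounded) simp_all
    then show ?thesis by simp
  qed
  have "x + y \<le> z" using assms(1) unfolding region_def by simp
  from round_on_ray[OF fin aff(3) this bound] obtain z' where
    z': "x + y \<le> z'" "z' \<in> R \<or> z' = x + y" "h z \<le> h z'" by blast
  have "region x y z'" using assms(1) z'(1) unfolding region_def by simp
  moreover have "vertex x y z'" using assms(2,3) z'(2) unfolding vertex_def by blast
  moreover have "f x + g y + h z \<le> f x + g y + h z'" using z'(3) by simp
  ultimately show ?thesis unfolding dominated_def by blast
qed

text \<open>
  First \<open>y\<close> moves while \<open>z\<close> is fixed. If it gets stuck on the face \<open>x + y = z\<close>, then \<open>y\<close> and \<open>z\<close> move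
  along this face together until one of them reaches a breakpoint.
\<close>

lemma dominated_fixed_x:
  assumes reg: "region x y z" and x: "x \<in> R"
  shows "dominated x y z"
proof (cases pin_y)
  case True
  then have "y = 0" using reg unfolding region_def by simp
  then show ?thesis using dominated_fixed_xy[OF reg x] zero by blast
next
  case False
  have "0 \<le> y" "y \<le> z - x" using reg by (auto simp: region_def)
  from round_in_interval[OF fin aff(2) this] obtain y' where
    y': "0 \<le> y'" "y' \<le> z - x" "y' \<in> R \<or> y' = 0 \<or> y' = z - x" "g y \<le> g y'" by blast
  have reg': "region x y' z" using reg y'(1,2) False unfolding region_def by simp
  have "dominated x y' z"
  proof (cases "y' \<in> R")
    case True
    then show ?thesis using dominated_fixed_xy[OF reg' x] by simp
  next
    case notR: False
    then have z: "z = y' + x" using y' zero by auto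
    define D where "D = R \<union> (\<lambda>d. d - x) ` R"
    have aff': "affine_between D (\<lambda>t. g t + h (t + x))"
      using affine_between_mono[OF aff(2)]
        affine_between_mono[OF affine_between_shift[OF aff(3), of x]]
      by (intro affine_between_add) (auto simp: D_def)
    have bound: "g s + h (s + x) \<le> B - f x" if "0 \<le> s" for s
    proof -
      have "f x + g s + h (s + x) \<le> B"
        using reg False that unfolding region_def by (intro bounded) simp_all
      then show ?thesis by simp
    qed
    have "finite D" using fin by (simp add: D_def)
    from round_on_ray[OF this aff' y'(1) bound] obtain s where
      s: "0 \<le> s" "s \<in> D \<or> s = 0" "g y' + h (y' + x) \<le> g s + h (s + x)" by blast
    have "region x s (s + x)" using reg False s(1) unfolding region_def by simp
    moreover have "vertex x s (s + x)" using s(2) x zero by (auto simp: D_def vertex_def)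
    moreover have "f x + g y' + h z \<le> f x + g s + h (s + x)" using s(3) z by simp
    ultimately show ?thesis unfolding dominated_def by blast
  qed
  then show ?thesis by (rule dominated_step) (use y'(4) in simp)
qed

end

context separable_maximization
begin

interpretation swapped: separable_maximization R g f h pin_y pin_x B
  using fin zero aff bounded
  by unfold_locales (auto simp: add.commute)

lemma dominated_fixed_y:
  assumes "region x y z" "y \<in> R"
  shows "dominated x y z"
proof -
  have "swapped.region y x z" using assms by (auto simp: region_def swapped.region_def)
  from swapped.dominated_fixed_x[OF this assms(2)] obtain y' x' z' where
    "swapped.region y' x' z'" "swapped.vertex y' x' z'" "g y + f x + h z \<le> g y' + f x' + h z'"
    unfolding swapped.dominated_def by blast
  then have "region x' y' z'" "vertex x' y' z'" "f x + g y + h z \<le> f x' + g y' + h z'"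
    by (auto simp: region_def swapped.region_def vertex_def swapped.vertex_def)
  then show ?thesis unfolding dominated_def by blast
qed

text \<open>
  Without pinned coordinates, \<open>x\<close> moves until it reaches a breakpoint or the face \<open>x + y = z\<close>. On this
  face the point slides with \<open>z\<close> fixed until \<open>x\<close> or \<open>y\<close> is a breakpoint, which leaves the cases
  treated before.
\<close>

theorem region_dominated:
  assumes reg: "region x y z"
  shows "dominated x y z"
proof (cases "pin_x \<or> pin_y")
  case True
  then have "x \<in> R \<or> y \<in> R" using reg zero by (auto simp: region_def)
  then show ?thesis using dominated_fixed_x dominated_fixed_y reg by blast
next
  case False
  have "0 \<le> x" "x \<le> z - y" using reg by (auto simp: region_def)
  from round_in_interval[OF fin aff(1) this] obtain x' where
    x': "0 \<le> x'" "x' \<le> z - y" "x' \<in> R \<or> x' = 0 \<or> x' = z - y" "f x \<le> f x'" by blast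
  have reg': "region x' y z" using reg x'(1,2) False unfolding region_def by simp
  have "dominated x' y z"
  proof (cases "x' \<in> R")
    case True
    then show ?thesis using dominated_fixed_x[OF reg'] by simp
  next
    case notR: False
    then have x'_eq: "x' = z - y" using x' zero by auto
    define D where "D = R \<union> (\<lambda>d. z - d) ` R"
    have aff': "affine_between D (\<lambda>t. f (z - t) + g t)"
      using affine_between_mono[OF aff(2)]
        affine_between_mono[OF affine_between_reflect[OF aff(1), of z]]
      by (intro affine_between_add) (auto simp: D_def)
    have "finite D" "0 \<le> y" "y \<le> z" using fin reg' by (auto simp: D_def region_def)
    from round_in_interval[OF this(1) aff' this(2,3)] obtain t where
      t: "0 \<le> t" "t \<le> z" "t \<in> D \<or> t = 0 \<or> t = z" "f (z - y) + g y \<le> f (z - t) + g t" by blast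
    have reg_t: "region (z - t) t z" using t(1,2) False unfolding region_def by simp
    have "t \<in> R \<or> z - t \<in> R" using t(3) zero by (auto simp: D_def)
    then have "dominated (z - t) t z"
      using dominated_fixed_x[OF reg_t] dominated_fixed_y[OF reg_t] by blast
    then show ?thesis by (rule dominated_step) (use t(4) x'_eq in simp)
  qed
  then show ?thesis by (rule dominated_step) (use x'(4) in simp)
qed

end

context two_past_assortments
begin

definition candidates :: "nat \<Rightarrow> nat \<Rightarrow> nat \<Rightarrow> (real \<times> real \<times> real) set" where
  "candidates i j k = {(r i, r j, r k), (r i, r j, r i + r j), (r i, r k - r i, r k),
     (r k - r j, r j, r k)}"

lemma feasible_iff: "feasible x y z \<longleftrightarrow> 0 \<le> x \<and> 0 \<le> y \<and> x + y \<le> z \<and>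
    (0 \<notin> S2 \<longrightarrow> x = 0) \<and> (0 \<notin> S1 \<longrightarrow> y = 0)"
  using zero_P r_zero by (auto simp: feasible_def offered_def)

text \<open>
  Boundedness comes for free from weak duality: a dual value never exceeds the revenue that a
  consistent distribution earns.
\<close>

lemma dual_value_bounded:
  assumes "consistent \<noteq> {}"
  obtains B where "\<And>x y z. feasible x y z \<Longrightarrow> dual_value x y z \<le> B"
proof -
  obtain l where l: "l \<in> consistent" using assms by blast
  show ?thesis
  proof
    fix x y z assume f: "feasible x y z"
    have off: "offered x y \<subseteq> P" "offered x y \<noteq> {}" using f by (auto simp: offered_def feasible_def)
    have "dual_value x y z \<le> expected_revenue I l (offered x y)"
      by (rule dual_value_le_revenue[OF f l])
    also have "\<dots> \<le> (\<Sum>\<sigma>\<in>rankings I. sum r P * l \<sigma>)"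
      unfolding expected_revenue_eq[OF off]
    proof (intro sum_mono mult_right_mono)
      fix \<sigma> assume "\<sigma> \<in> rankings I"
      then show "0 \<le> l \<sigma>" using l by (auto simp: consistent_def)
      show "r (fav \<sigma> (offered x y)) \<le> sum r P"
        using fav_in(1)[OF off] off finite_P r_nonneg by (intro member_le_sum) auto
    qed
    finally show "dual_value x y z \<le> (\<Sum>\<sigma>\<in>rankings I. sum r P * l \<sigma>)" .
  qed
qed

lemma dominated_by_candidate:
  assumes ne: "consistent \<noteq> {}" and f: "feasible x y z"
  obtains i j k x' y' z' where "i \<in> P" "j \<in> P" "k \<in> P" "(x', y', z') \<in> candidates i j k"
    "feasible x' y' z'" "dual_value x y z \<le> dual_value x' y' z'"
proof -
  obtain B where B: "\<And>x y z. feasible x y z \<Longrightarrow> dual_value x y z \<le> B"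
    using dual_value_bounded[OF ne] by blast
  define H where "H c t = (\<Sum>k\<in>P. c k * hinge (t - r k))" for c t
  have val: "dual_value x y z = H coef_x x + H coef_y y + (z + H coef_z z)" for x y z
    by (simp add: dual_value_def H_def sum.distrib)
  have aff: "affine_between (r ` P) (H c)" for c
    unfolding H_def hinge_def
    by (intro affine_between_sum affine_between_cmult affine_between_hinge) auto
  have aff': "affine_between (r ` P) (\<lambda>t. t + H coef_z t)"
    using affine_between_add[OF affine_between_affine[of _ 1 0] aff] by simp
  interpret separable_maximization "r ` P" "H coef_x" "H coef_y" "\<lambda>t. t + H coef_z t"
    "0 \<notin> S2" "0 \<notin> S1" B
  proof
    show "0 \<in> r ` P" using zero_P r_zero image_eqI[of 0 r 0 P] by simp
    show "finite (r ` P)" using finite_P by simp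
    fix x y z :: real
    assume "0 \<le> x" "0 \<le> y" "x + y \<le> z" "0 \<notin> S2 \<longrightarrow> x = 0" "0 \<notin> S1 \<longrightarrow> y = 0"
    then show "H coef_x x + H coef_y y + (z + H coef_z z) \<le> B"
      using B[of x y z] by (simp only: val feasible_iff)
  qed (rule aff aff')+
  have "region x y z" using f by (simp add: region_def feasible_iff)
  then obtain x' y' z' where *: "region x' y' z'" "vertex x' y' z'"
      "dual_value x y z \<le> dual_value x' y' z'"
    using region_dominated unfolding dominated_def val by blast
  have "feasible x' y' z'" using *(1) by (simp add: region_def feasible_iff)
  moreover have "\<exists>i\<in>P. \<exists>j\<in>P. \<exists>k\<in>P. (x', y', z') \<in> candidates i j k"
    using *(2) zero_P unfolding vertex_def candidates_def by auto
  ultimately show ?thesis using that *(3) by blast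
qed

text \<open>
  The worst case of \<open>offered x y\<close> is at least \<open>dual_value x y z\<close> by weak duality, and no assortment
  has a worst case above the best candidate, so equality holds for \<open>offered x y\<close>.
\<close>

theorem best_candidate_optimal:
  assumes ne: "consistent \<noteq> {}" and f: "feasible x y z"
    and best: "\<And>i j k x' y' z'. i \<in> P \<Longrightarrow> j \<in> P \<Longrightarrow> k \<in> P \<Longrightarrow> (x', y', z') \<in> candidates i j k \<Longrightarrow>
      feasible x' y' z' \<Longrightarrow> dual_value x' y' z' \<le> dual_value x y z"
  shows "robust_optimum N 0 I (offered x y) (dual_value x y z)"
proof -
  have bound: "\<exists>v\<le>dual_value x y z. has_minimum (\<lambda>l. expected_revenue I l S) consistent v"
    if S: "S \<in> assortments I" for S
  proof -
    obtain v x1 y1 z1 where v: "has_minimum (\<lambda>l. expected_revenue I l S) consistent v"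
      "feasible x1 y1 z1" "v \<le> dual_value x1 y1 z1" using worst_case_attained[OF S ne] by blast
    obtain i j k x' y' z' where "i \<in> P" "j \<in> P" "k \<in> P" "(x', y', z') \<in> candidates i j k"
      "feasible x' y' z'" "dual_value x1 y1 z1 \<le> dual_value x' y' z'"
      using dominated_by_candidate[OF ne v(2)] by blast
    with best have "dual_value x1 y1 z1 \<le> dual_value x y z" by (meson order_trans)
    then have "v \<le> dual_value x y z" using v(3) by simp
    then show ?thesis using v(1) by blast
  qed
  obtain v where v: "v \<le> dual_value x y z"
    "has_minimum (\<lambda>l. expected_revenue I l (offered x y)) consistent v"
    using bound[OF offered_assortment[OF f]] by blast
  then obtain l where "l \<in> consistent" "v = expected_revenue I l (offered x y)"
    by (auto simp: has_minimum_def)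
  then have "v = dual_value x y z" using dual_value_le_revenue[OF f] v(1) by (simp add: order_antisym)
  with v(2) have "has_minimum (\<lambda>l. expected_revenue I l (offered x y)) consistent (dual_value x y z)"
    by simp
  then show ?thesis
    unfolding robust_optimum_def uncertainty_set_eq using bound offered_assortment[OF f] by blast
qed

end

section \<open>Running time of structured programs\<close>

fun nat_writes :: "prog \<Rightarrow> string set" where
  "nat_writes Skip = {}"
| "nat_writes (NAssign x a e) = {x}"
| "nat_writes (RAssign x a e) = {}"
| "nat_writes (Seq c d) = nat_writes c \<union> nat_writes d"
| "nat_writes (Cond b c d) = nat_writes c \<union> nat_writes d"
| "nat_writes (While b c) = nat_writes c"

fun real_writes :: "prog \<Rightarrow> string set" where
  "real_writes Skip = {}"
| "real_writes (NAssign x a e) = {}"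
| "real_writes (RAssign x a e) = {x}"
| "real_writes (Seq c d) = real_writes c \<union> real_writes d"
| "real_writes (Cond b c d) = real_writes c \<union> real_writes d"
| "real_writes (While b c) = real_writes c"

text \<open>
  Everything outside the arrays that occur on left-hand sides survives a run. This is how the input
  and the counters of enclosing loops are carried through inner programs.
\<close>

definition framed :: "prog \<Rightarrow> mem \<Rightarrow> mem \<Rightarrow> bool" where
  "framed c s s' \<longleftrightarrow> (\<forall>x. x \<notin> nat_writes c \<longrightarrow> fst s' x = fst s x) \<and>
     (\<forall>x. x \<notin> real_writes c \<longrightarrow> snd s' x = snd s x)"

lemma exec_framed: "exec c s t s' \<Longrightarrow> framed c s s'"
  by (induction rule: exec.induct) (auto simp: framed_def)

text \<open>A total correctness triple with a bound on the running time.\<close>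

definition achieves :: "prog \<Rightarrow> mem \<Rightarrow> nat \<Rightarrow> (mem \<Rightarrow> bool) \<Rightarrow> bool" where
  "achieves c s T Q \<longleftrightarrow> (\<exists>t s'. exec c s t s' \<and> t \<le> T \<and> Q s')"

lemma achieves_weaken:
  assumes "achieves c s T Q" "T \<le> T'" "\<And>s'. framed c s s' \<Longrightarrow> Q s' \<Longrightarrow> Q' s'"
  shows "achieves c s T' Q'"
proof -
  obtain t s' where "exec c s t s'" "t \<le> T" "Q s'" using assms(1) by (auto simp: achieves_def)
  then show ?thesis unfolding achieves_def
    using assms(2,3) exec_framed by (intro exI[of _ t] exI[of _ s']) auto
qed

lemma achieves_Seq:
  assumes "achieves c s T R" "\<And>s'. framed c s s' \<Longrightarrow> R s' \<Longrightarrow> achieves d s' U Q"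
  shows "achieves (Seq c d) s (T + U) Q"
proof -
  obtain t s' where c: "exec c s t s'" "t \<le> T" "R s'" using assms(1) by (auto simp: achieves_def)
  obtain u s'' where d: "exec d s' u s''" "u \<le> U" "Q s''"
    using assms(2)[OF exec_framed[OF c(1)] c(3)] by (auto simp: achieves_def)
  show ?thesis unfolding achieves_def using exec.Seq[OF c(1) d(1)] c(2) d(2,3)
    by (intro exI[of _ "t + u"] exI[of _ s'']) auto
qed

lemma achieves_Cond:
  assumes "bval b s \<Longrightarrow> achieves c s T Q" "\<not> bval b s \<Longrightarrow> achieves d s T Q"
  shows "achieves (Cond b c d) s (1 + bcost b + T) Q"
proof (cases "bval b s")
  case True
  then obtain t s' where "exec c s t s'" "t \<le> T" "Q s'" using assms(1) by (auto simp: achieves_def)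
  then show ?thesis using exec.CondTrue[OF True] unfolding achieves_def
    by (intro exI[of _ "1 + bcost b + t"] exI[of _ s']) auto
next
  case False
  then obtain t s' where "exec d s t s'" "t \<le> T" "Q s'" using assms(2) by (auto simp: achieves_def)
  then show ?thesis using exec.CondFalse[OF False] unfolding achieves_def
    by (intro exI[of _ "1 + bcost b + t"] exI[of _ s']) auto
qed

text \<open>
  Loop-free code is executed symbolically: its final memory is \<open>effect\<close>, and its cost is at most
  that of the more expensive branches.
\<close>

fun loop_free :: "prog \<Rightarrow> bool" where
  "loop_free (Seq c d) \<longleftrightarrow> loop_free c \<and> loop_free d"
| "loop_free (Cond b c d) \<longleftrightarrow> loop_free c \<and> loop_free d"
| "loop_free (While b c) \<longleftrightarrow> False"
| "loop_free _ \<longleftrightarrow> True"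

fun effect :: "prog \<Rightarrow> mem \<Rightarrow> mem" where
  "effect (NAssign x a e) s = ((fst s)(x := (fst s x)(nval a s := nval e s)), snd s)"
| "effect (RAssign x a e) s = (fst s, (snd s)(x := (snd s x)(nval a s := rval e s)))"
| "effect (Seq c d) s = effect d (effect c s)"
| "effect (Cond b c d) s = (if bval b s then effect c s else effect d s)"
| "effect _ s = s"

fun max_cost :: "prog \<Rightarrow> nat" where
  "max_cost (NAssign x a e) = 1 + ncost a + ncost e"
| "max_cost (RAssign x a e) = 1 + ncost a + rcost e"
| "max_cost (Seq c d) = max_cost c + max_cost d"
| "max_cost (Cond b c d) = 1 + bcost b + max (max_cost c) (max_cost d)"
| "max_cost _ = 1"

lemma achieves_effect:
  "loop_free c \<Longrightarrow> achieves c s (max_cost c) (\<lambda>s'. s' = effect c s)"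
proof (induction c arbitrary: s)
  case Skip
  show ?case unfolding achieves_def
    by (intro exI conjI, rule exec.Skip) simp_all
next
  case (NAssign x a e)
  show ?case unfolding achieves_def
    by (intro exI conjI, rule exec.NAssign) simp_all
next
  case (RAssign x a e)
  show ?case unfolding achieves_def
    by (intro exI conjI, rule exec.RAssign) simp_all
next
  case (Seq c d)
  then have *: "achieves c s (max_cost c) (\<lambda>s'. s' = effect c s)"
    "achieves d (effect c s) (max_cost d) (\<lambda>s'. s' = effect d (effect c s))" by auto
  have "achieves (Seq c d) s (max_cost c + max_cost d) (\<lambda>s'. s' = effect d (effect c s))"
    by (rule achieves_Seq[OF *(1)]) (use *(2) in simp)
  then show ?case by simp
next
  case (Cond b c d)
  then have *: "achieves c s (max_cost c) (\<lambda>s'. s' = effect c s)"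
    "achieves d s (max_cost d) (\<lambda>s'. s' = effect d s)" by auto
  have "achieves (Cond b c d) s (1 + bcost b + max (max_cost c) (max_cost d))
      (\<lambda>s'. s' = effect (Cond b c d) s)"
  proof (rule achieves_Cond)
    show "achieves c s (max (max_cost c) (max_cost d)) (\<lambda>s'. s' = effect (Cond b c d) s)"
      if "bval b s"
      using that by (intro achieves_weaken[OF *(1)]) auto
    show "achieves d s (max (max_cost c) (max_cost d)) (\<lambda>s'. s' = effect (Cond b c d) s)"
      if "\<not> bval b s"
      using that by (intro achieves_weaken[OF *(2)]) auto
  qed
  then show ?case by simp
qed simp

lemma achieves_loop_free:
  "loop_free c \<Longrightarrow> Q (effect c s) \<Longrightarrow> achieves c s (max_cost c) Q"
  using achieves_weaken[OF achieves_effect] by blast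

abbreviation "nat_var x \<equiv> NCell x (NConst 0)"
abbreviation "real_var x \<equiv> RCell x (NConst 0)"

text \<open>The loop runs over all \<open>n + 1\<close> products including 0.\<close>

definition for_products :: "string \<Rightarrow> prog \<Rightarrow> prog" where
  "for_products i c =
     Seq (NAssign i (NConst 0) (NConst 0))
       (While (BNot (NLess (nat_var ''n'') (nat_var i)))
          (Seq c (NAssign i (NConst 0) (NAdd (nat_var i) (NConst 1)))))"

lemma writes_for_products [simp]:
  "nat_writes (for_products i c) = insert i (nat_writes c)"
  "real_writes (for_products i c) = real_writes c"
  by (auto simp: for_products_def)

text \<open>
  Replacing a whole array by an arbitrary one expresses that an invariant ignores the loop counter
  stored in it.
\<close>

definition set_nat :: "string \<Rightarrow> (nat \<Rightarrow> nat) \<Rightarrow> mem \<Rightarrow> mem" where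
  "set_nat i a s = ((fst s)(i := a), snd s)"

text \<open>
  Besides the body, an iteration pays 7 for the test and 6 for the increment; initialization costs 3
  and the final failing test 7.
\<close>

lemma achieves_for_products:
  assumes n: "fst s ''n'' 0 = n" and i: "i \<notin> nat_writes c" "''n'' \<notin> insert i (nat_writes c)"
    and indep: "\<And>k s a. Inv k s \<Longrightarrow> Inv k (set_nat i a s)"
    and init: "Inv 0 s"
    and step: "\<And>k s'. k \<le> n \<Longrightarrow> framed (for_products i c) s s' \<Longrightarrow> fst s' i 0 = k \<Longrightarrow>
      Inv k s' \<Longrightarrow> achieves c s' T (Inv (Suc k))"
  shows "achieves (for_products i c) s (10 + (n + 1) * (T + 13)) (Inv (Suc n))"
proof -
  define inc where "inc = NAssign i (NConst 0) (NAdd (nat_var i) (NConst 1))"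
  define guard where "guard = BNot (NLess (nat_var ''n'') (nat_var i))"
  have cost: "bcost guard = 6" by (simp add: guard_def)
  have loop: "achieves (While guard (Seq c inc)) s' (7 + m * (T + 13)) (Inv (Suc n))"
    if "m + k = Suc n" "framed (for_products i c) s s'" "fst s' i 0 = k" "Inv k s'" for m k s'
    using that
  proof (induction m arbitrary: k s')
    case 0
    have "fst s' ''n'' 0 = n" using 0(2) n i(2) by (simp add: framed_def)
    then have "\<not> bval guard s'" using 0 by (simp add: guard_def)
    from exec.WhileFalse[OF this, of "Seq c inc"] have "exec (While guard (Seq c inc)) s' 7 s'"
      using cost by simp
    then show ?case using 0 unfolding achieves_def by (intro exI[of _ 7] exI[of _ s']) simp
  next
    case (Suc m)
    have n': "fst s' ''n'' 0 = n" using Suc.prems(2) n i(2) by (simp add: framed_def)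
    then have b: "bval guard s'" using Suc.prems by (simp add: guard_def)
    have "achieves c s' T (Inv (Suc k))" using step Suc.prems by simp
    then obtain t u where t: "exec c s' t u" "t \<le> T" "Inv (Suc k) u" by (auto simp: achieves_def)
    have fr: "framed c s' u" by (rule exec_framed[OF t(1)])
    then have ui: "fst u i 0 = k" using i Suc.prems(3) by (simp add: framed_def)
    define u' where "u' = set_nat i ((fst u i)(0 := Suc k)) u"
    have inc: "exec inc u 6 u'"
      using exec.NAssign[of i "NConst 0" "NAdd (nat_var i) (NConst 1)" u] ui
      by (simp add: inc_def u'_def set_nat_def eval_nat_numeral)
    have "framed (for_products i c) s u'"
      using Suc.prems(2) fr by (auto simp: framed_def u'_def set_nat_def)
    moreover have "fst u' i 0 = Suc k" by (simp add: u'_def set_nat_def)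
    moreover have "Inv (Suc k) u'" using indep t(3) by (simp add: u'_def)
    ultimately have "achieves (While guard (Seq c inc)) u' (7 + m * (T + 13)) (Inv (Suc n))"
      using Suc.IH[of "Suc k" u'] Suc.prems(1) by simp
    then obtain t' w where w: "exec (While guard (Seq c inc)) u' t' w"
      "t' \<le> 7 + m * (T + 13)" "Inv (Suc n) w" by (auto simp: achieves_def)
    have "exec (While guard (Seq c inc)) s' (1 + bcost guard + (t + 6) + t') w"
      by (rule exec.WhileTrue[OF b exec.Seq[OF t(1) inc] w(1)])
    moreover have "1 + bcost guard + (t + 6) + t' \<le> 7 + Suc m * (T + 13)"
      using cost t(2) w(2) by simp
    ultimately show ?case using w(3) unfolding achieves_def by blast
  qed
  define s0 where "s0 = set_nat i ((fst s i)(0 := 0)) s"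
  have "exec (NAssign i (NConst 0) (NConst 0)) s 3 s0"
    using exec.NAssign[of i "NConst 0" "NConst 0" s] by (simp add: s0_def set_nat_def numeral_3_eq_3)
  then have reset: "achieves (NAssign i (NConst 0) (NConst 0)) s 3 (\<lambda>s'. s' = s0)"
    unfolding achieves_def by blast
  have from_s0: "achieves (While guard (Seq c inc)) s0 (7 + (n + 1) * (T + 13)) (Inv (Suc n))"
    using loop[of "n + 1" 0 s0] indep init by (simp add: s0_def set_nat_def framed_def)
  have "achieves (for_products i c) s (3 + (7 + (n + 1) * (T + 13))) (Inv (Suc n))"
    unfolding for_products_def inc_def[symmetric] guard_def[symmetric]
    by (rule achieves_Seq[OF reset]) (use from_s0 in blast)
  then show ?thesis by (rule achieves_weaken) auto
qed

section \<open>The enumeration program\<close>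

abbreviation "set_real x e \<equiv> RAssign x (NConst 0) e"

text \<open>
  The flags and the sales of the second past assortment start at address \<open>n + 1\<close>. The counters \<open>i\<close>,
  \<open>j\<close>, \<open>k\<close> enumerate the triples of products, and \<open>l\<close> is the counter of every other loop. The point
  under inspection is in \<open>x\<close>, \<open>y\<close>, \<open>z\<close>, its dual value is accumulated in \<open>f\<close> from the
  coefficients in \<open>cx\<close>, \<open>cy\<close>, \<open>cz\<close>, and the best thresholds so far are in \<open>bx\<close>, \<open>by\<close>.
\<close>

definition in_past1 :: "nexp \<Rightarrow> bexp" where
  "in_past1 a = BNot (NEq (NCell ''S'' a) (NConst 0))"
definition in_past2 :: "nexp \<Rightarrow> bexp" where
  "in_past2 a = BNot (NEq (NCell ''S'' (NAdd (NAdd (nat_var ''n'') (NConst 1)) a)) (NConst 0))"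
definition sales1 :: "nexp \<Rightarrow> rexp" where
  "sales1 a = RCell ''v'' a"
definition sales2 :: "nexp \<Rightarrow> rexp" where
  "sales2 a = RCell ''v'' (NAdd (NAdd (nat_var ''n'') (NConst 1)) a)"

definition set_coefs :: "rexp \<Rightarrow> rexp \<Rightarrow> rexp \<Rightarrow> prog" where
  "set_coefs a b c = Seq (RAssign ''cx'' (nat_var ''l'') a)
     (Seq (RAssign ''cy'' (nat_var ''l'') b) (RAssign ''cz'' (nat_var ''l'') c))"

definition coef_step :: prog where
  "coef_step = (let k = nat_var ''l''; p = sales1 k; q = sales2 k; zero = RConst 0 in
     Cond (in_past2 k)
       (Cond (in_past1 k)
          (Cond (RLess p q)
             (set_coefs (RSub p q) zero (RSub zero p))
             (set_coefs zero (RSub q p) (RSub zero q)))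
          (set_coefs zero q (RSub zero q)))
       (set_coefs p zero (RSub zero p)))"

definition add_hinge :: "string \<Rightarrow> string \<Rightarrow> prog" where
  "add_hinge c x = Cond (RLess (RCell ''r'' (nat_var ''l'')) (real_var x))
     (set_real ''f'' (RAdd (real_var ''f'') (RMul (RCell c (nat_var ''l''))
        (RSub (real_var x) (RCell ''r'' (nat_var ''l''))))))
     Skip"

definition hinge_step :: prog where
  "hinge_step = Seq (add_hinge ''cx'' ''x'') (Seq (add_hinge ''cy'' ''y'') (add_hinge ''cz'' ''z''))"

definition evaluate :: prog where
  "evaluate = Seq (set_real ''f'' (real_var ''z'')) (for_products ''l'' hinge_step)"

definition feasible_test :: bexp where
  "feasible_test =
     BAnd (BNot (RLess (real_var ''x'') (RConst 0)))
     (BAnd (BNot (RLess (real_var ''y'') (RConst 0)))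
     (BAnd (BNot (RLess (real_var ''z'') (RAdd (real_var ''x'') (real_var ''y''))))
     (BAnd (BNot (BAnd (BNot (in_past2 (NConst 0))) (RLess (RConst 0) (real_var ''x''))))
        (BNot (BAnd (BNot (in_past1 (NConst 0))) (RLess (RConst 0) (real_var ''y'')))))))"

text \<open>
  The third coordinate of the best point is not recorded, because the thresholds alone determine
  the assortment. All cells are initially 0, so the search starts from the feasible point
  \<open>(0, 0, 0)\<close> of value 0.
\<close>

definition record_best :: prog where
  "record_best = Cond (RLess (real_var ''value'') (real_var ''f''))
     (Seq (set_real ''value'' (real_var ''f''))
       (Seq (set_real ''bx'' (real_var ''x'')) (set_real ''by'' (real_var ''y''))))
     Skip"

definition visit :: "rexp \<Rightarrow> rexp \<Rightarrow> rexp \<Rightarrow> prog" where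
  "visit a b c = Seq (Seq (set_real ''x'' a) (Seq (set_real ''y'' b) (set_real ''z'' c)))
     (Cond feasible_test (Seq evaluate record_best) Skip)"

text \<open>
  The expressions do not read \<open>x\<close>, \<open>y\<close>, \<open>z\<close>, so that consecutive visits do not interfere.
\<close>

definition visit_candidates :: prog where
  "visit_candidates = (let a = RCell ''r'' (nat_var ''i''); b = RCell ''r'' (nat_var ''j'');
       c = RCell ''r'' (nat_var ''k'') in
     Seq (visit a b c) (Seq (visit a b (RAdd a b))
       (Seq (visit a (RSub c a) c) (visit (RSub c b) b c))))"

definition search :: prog where
  "search = for_products ''i'' (for_products ''j'' (for_products ''k'' visit_candidates))"

definition output_step :: prog where
  "output_step = (let k = nat_var ''l''; r = RCell ''r'' k in
     Cond (BAnd (BNot (BAnd (BNot (in_past2 k)) (RLess r (real_var ''bx''))))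
            (BNot (BAnd (BNot (in_past1 k)) (RLess r (real_var ''by'')))))
       (NAssign ''assortment'' k (NConst 1)) Skip)"

definition solver :: prog where
  "solver = Seq (for_products ''l'' coef_step) (Seq search (for_products ''l'' output_step))"

lemmas program_defs = in_past1_def in_past2_def sales1_def sales2_def set_coefs_def coef_step_def
  add_hinge_def hinge_step_def evaluate_def feasible_test_def record_best_def visit_def
  visit_candidates_def search_def output_step_def solver_def

context two_past_assortments
begin

abbreviation "n \<equiv> num_products I"

definition input_in :: "mem \<Rightarrow> bool" where
  "input_in s \<longleftrightarrow> fst s ''n'' 0 = n \<and>
     (\<forall>k\<le>n. snd s ''r'' k = r k \<and> snd s ''v'' k = p k \<and> snd s ''v'' (Suc (n + k)) = q k \<and>
        (fst s ''S'' k \<noteq> 0 \<longleftrightarrow> k \<in> S1) \<and> (fst s ''S'' (Suc (n + k)) \<noteq> 0 \<longleftrightarrow> k \<in> S2))"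

definition coefs_in :: "nat \<Rightarrow> mem \<Rightarrow> bool" where
  "coefs_in m s \<longleftrightarrow>
     (\<forall>k<m. snd s ''cx'' k = coef_x k \<and> snd s ''cy'' k = coef_y k \<and> snd s ''cz'' k = coef_z k)"

lemma input_in_framed:
  assumes "framed c s s'" "input_in s" "''n'' \<notin> nat_writes c" "''S'' \<notin> nat_writes c"
    "''r'' \<notin> real_writes c" "''v'' \<notin> real_writes c"
  shows "input_in s'"
  using assms by (simp add: framed_def input_in_def)

lemma input_mem_in: "input_in (input_mem I)"
proof -
  have "Suc (n + k) div Suc n = 1" "Suc (n + k) mod Suc n = k" if "k \<le> n" for k
  proof -
    have eq: "Suc (n + k) = k + Suc n * 1" by simp
    show "Suc (n + k) div Suc n = 1" unfolding eq using that by (simp del: mult_Suc mult_Suc_right)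
    show "Suc (n + k) mod Suc n = k" unfolding eq using that by (simp del: mult_Suc mult_Suc_right)
  qed
  then show ?thesis
    using two by (auto simp: input_in_def input_mem_def Let_def S1_def S2_def p_def q_def
      numeral_2_eq_2)
qed

lemma achieves_coefs:
  assumes "input_in s"
  shows "achieves (for_products ''l'' coef_step) s (10 + (n + 1) * (max_cost coef_step + 13))
    (coefs_in (Suc n))"
proof (rule achieves_for_products)
  show "fst s ''n'' 0 = n" using assms by (simp add: input_in_def)
next
  fix k s' assume k: "k \<le> n" "framed (for_products ''l'' coef_step) s s'" "fst s' ''l'' 0 = k"
    "coefs_in k s'"
  have s': "input_in s'"
    by (rule input_in_framed[OF k(2) assms]) (simp_all add: program_defs Let_def)
  have v: "snd s' ''v'' k = p k" "snd s' ''v'' (Suc (n + k)) = q k"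
    "(fst s' ''S'' k = 0) = (k \<notin> S1)" "(fst s' ''S'' (Suc (n + k)) = 0) = (k \<notin> S2)"
    "fst s' ''n'' 0 = n"
    using s' k(1) by (auto simp: input_in_def)
  have "k \<in> S1 \<or> k \<in> S2" using k(1) S12 by (auto simp: P_eq)
  note v = v this
  show "achieves coef_step s' (max_cost coef_step) (coefs_in (Suc k))"
  proof (rule achieves_loop_free)
    show "loop_free coef_step" by (simp add: program_defs Let_def)
    show "coefs_in (Suc k) (effect coef_step s')"
      using k(3,4) v
      by (auto simp: program_defs Let_def coefs_in_def coef_x_def coef_y_def coef_z_def less_Suc_eq)
  qed
qed (auto simp: program_defs Let_def coefs_in_def set_nat_def)

definition hinge_terms :: "real \<Rightarrow> real \<Rightarrow> real \<Rightarrow> nat \<Rightarrow> real" where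
  "hinge_terms x y z k =
     coef_x k * hinge (x - r k) + coef_y k * hinge (y - r k) + coef_z k * hinge (z - r k)"

lemma effect_add_hinge:
  assumes "snd s ''r'' k = r k" "fst s ''l'' 0 = k" "x \<noteq> ''f''"
  shows "effect (add_hinge c x) s = (fst s, (snd s)(''f'' := (snd s ''f'')
    (0 := snd s ''f'' 0 + snd s c k * hinge (snd s x 0 - r k))))"
proof (cases "r k < snd s x 0")
  case True
  then show ?thesis using assms by (simp add: add_hinge_def hinge_def)
next
  case False
  then have "hinge (snd s x 0 - r k) = 0" by (simp add: hinge_def)
  then show ?thesis using assms False by (simp add: add_hinge_def)
qed

lemma achieves_evaluate:
  assumes s: "input_in s" "coefs_in (Suc n) s"
    and xyz: "snd s ''x'' 0 = x" "snd s ''y'' 0 = y" "snd s ''z'' 0 = z"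
  shows "achieves evaluate s (14 + (n + 1) * (max_cost hinge_step + 13))
    (\<lambda>s'. snd s' ''f'' 0 = dual_value x y z)"
proof -
  define Q where "Q k s' \<longleftrightarrow> snd s' ''f'' 0 = z + (\<Sum>l<k. hinge_terms x y z l)" for k and s' :: mem
  have init: "achieves (set_real ''f'' (real_var ''z'')) s 4 (Q 0)"
    using achieves_loop_free[of "set_real ''f'' (real_var ''z'')" "Q 0" s] xyz
    by (simp add: Q_def eval_nat_numeral)
  have loop: "achieves (for_products ''l'' hinge_step) s1 (10 + (n + 1) * (max_cost hinge_step + 13))
      (Q (Suc n))" if fr1: "framed (set_real ''f'' (real_var ''z'')) s s1" and Q1: "Q 0 s1" for s1
  proof (rule achieves_for_products)
    have s1: "input_in s1" by (rule input_in_framed[OF fr1 s(1)]) simp_all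
    then show "fst s1 ''n'' 0 = n" by (simp add: input_in_def)
    fix k s2 assume k: "k \<le> n" "framed (for_products ''l'' hinge_step) s1 s2" "fst s2 ''l'' 0 = k"
      "Q k s2"
    have s2: "input_in s2"
      by (rule input_in_framed[OF k(2) s1]) (simp_all add: program_defs)
    have c: "snd s2 ''cx'' k = coef_x k" "snd s2 ''cy'' k = coef_y k" "snd s2 ''cz'' k = coef_z k"
      "snd s2 ''x'' 0 = x" "snd s2 ''y'' 0 = y" "snd s2 ''z'' 0 = z"
      using k(1,2) fr1 s(2) xyz by (auto simp: framed_def coefs_in_def program_defs)
    have rk: "snd s2 ''r'' k = r k" using s2 k(1) by (simp add: input_in_def)
    show "achieves hinge_step s2 (max_cost hinge_step) (Q (Suc k))"
    proof (rule achieves_loop_free)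
      show "loop_free hinge_step" by (simp add: program_defs)
      show "Q (Suc k) (effect hinge_step s2)"
        using k(3,4) c rk
        by (simp add: hinge_step_def effect_add_hinge[where k = k] Q_def hinge_terms_def)
    qed
  qed (use Q1 in \<open>auto simp: program_defs Q_def set_nat_def\<close>)
  have "achieves evaluate s (4 + (10 + (n + 1) * (max_cost hinge_step + 13))) (Q (Suc n))"
    unfolding evaluate_def by (rule achieves_Seq[OF init loop])
  then show ?thesis
  proof (rule achieves_weaken)
    fix s' assume "Q (Suc n) s'"
    then show "snd s' ''f'' 0 = dual_value x y z"
      by (simp add: Q_def dual_value_def P_eq lessThan_Suc_atMost hinge_terms_def)
  qed simp
qed

text \<open>
  The invariant of the search once the points of \<open>V\<close> have been visited. The quantifier over \<open>z\<close>
  stands for the coordinate that the program does not record.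
\<close>

definition best_of :: "(real \<times> real \<times> real) set \<Rightarrow> mem \<Rightarrow> bool" where
  "best_of V s \<longleftrightarrow> input_in s \<and> coefs_in (Suc n) s \<and> fst s ''assortment'' = (\<lambda>_. 0) \<and>
     (\<exists>z. feasible (snd s ''bx'' 0) (snd s ''by'' 0) z \<and>
        snd s ''value'' 0 = dual_value (snd s ''bx'' 0) (snd s ''by'' 0) z) \<and>
     (\<forall>(x, y, z)\<in>V. feasible x y z \<longrightarrow> dual_value x y z \<le> snd s ''value'' 0)"

lemma best_of_framed:
  assumes "framed c s s'" "best_of V s"
    "nat_writes c \<inter> {''n'', ''S'', ''assortment''} = {}"
    "real_writes c \<inter> {''r'', ''v'', ''cx'', ''cy'', ''cz'', ''bx'', ''by'', ''value''} = {}"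
  shows "best_of V s'"
proof -
  have "input_in s'" using assms by (intro input_in_framed[OF assms(1)]) (auto simp: best_of_def)
  moreover have "fst s' ''assortment'' = fst s ''assortment''" "snd s' ''cx'' = snd s ''cx''"
    "snd s' ''cy'' = snd s ''cy''" "snd s' ''cz'' = snd s ''cz''" "snd s' ''bx'' = snd s ''bx''"
    "snd s' ''by'' = snd s ''by''" "snd s' ''value'' = snd s ''value''"
    using assms(1,3,4) by (auto simp: framed_def)
  ultimately show ?thesis using assms(2) by (simp add: best_of_def coefs_in_def)
qed

lemma best_of_set_nat:
  "i \<notin> {''n'', ''S'', ''assortment''} \<Longrightarrow> best_of V s \<Longrightarrow> best_of V (set_nat i a s)"
  by (rule best_of_framed[of "NAssign i (NConst 0) (NConst 0)" s])
    (auto simp: framed_def set_nat_def)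

definition visit_cost :: nat where
  "visit_cost = bcost feasible_test + max_cost record_best
     + (n + 1) * (max_cost hinge_step + 13) + 16"

lemma bval_feasible_test:
  assumes "input_in s" "snd s ''x'' 0 = x" "snd s ''y'' 0 = y" "snd s ''z'' 0 = z"
  shows "bval feasible_test s \<longleftrightarrow> feasible x y z"
proof -
  have "(fst s ''S'' 0 = 0) = (0 \<notin> S1)" "(fst s ''S'' (Suc n) = 0) = (0 \<notin> S2)" "fst s ''n'' 0 = n"
    using assms(1) unfolding input_in_def by (auto dest: spec[of _ 0])
  then show ?thesis using assms(2-4)
    by (auto simp: feasible_test_def in_past1_def in_past2_def feasible_iff)
qed

lemma achieves_visit:
  assumes s: "best_of V s"
    and ex: "rval a s = x" "rval b (effect (set_real ''x'' a) s) = y"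
      "rval c (effect (set_real ''y'' b) (effect (set_real ''x'' a) s)) = z"
  shows "achieves (visit a b c) s (6 + rcost a + rcost b + rcost c + visit_cost)
    (best_of (insert (x, y, z) V))"
proof -
  define assign where "assign = Seq (set_real ''x'' a) (Seq (set_real ''y'' b) (set_real ''z'' c))"
  define Q where "Q s' \<longleftrightarrow> best_of V s' \<and> snd s' ''x'' 0 = x \<and> snd s' ''y'' 0 = y \<and> snd s' ''z'' 0 = z"
    for s'
  have "achieves assign s (max_cost assign)
    (\<lambda>s'. snd s' ''x'' 0 = x \<and> snd s' ''y'' 0 = y \<and> snd s' ''z'' 0 = z)"
    by (rule achieves_loop_free) (use ex in \<open>simp_all add: assign_def\<close>)
  then have assign: "achieves assign s (6 + rcost a + rcost b + rcost c) Q"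
  proof (rule achieves_weaken)
    show "max_cost assign \<le> 6 + rcost a + rcost b + rcost c" by (simp add: assign_def)
    fix s' assume "framed assign s s'" "snd s' ''x'' 0 = x \<and> snd s' ''y'' 0 = y \<and> snd s' ''z'' 0 = z"
    moreover have "best_of V s'"
      by (rule best_of_framed[OF \<open>framed assign s s'\<close> s]) (simp_all add: assign_def)
    ultimately show "Q s'" by (simp add: Q_def)
  qed
  have rest: "achieves (Cond feasible_test (Seq evaluate record_best) Skip) s1 visit_cost
      (best_of (insert (x, y, z) V))" if Q: "Q s1" for s1
  proof -
    have s1: "best_of V s1" "input_in s1" "coefs_in (Suc n) s1" and xyz: "snd s1 ''x'' 0 = x"
      "snd s1 ''y'' 0 = y" "snd s1 ''z'' 0 = z" using Q by (auto simp: Q_def best_of_def)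
    have "achieves (Cond feasible_test (Seq evaluate record_best) Skip) s1
      (1 + bcost feasible_test + (14 + (n + 1) * (max_cost hinge_step + 13) + max_cost record_best))
      (best_of (insert (x, y, z) V))"
    proof (rule achieves_Cond)
      assume "bval feasible_test s1"
      then have f: "feasible x y z" using bval_feasible_test[OF s1(2) xyz] by simp
      show "achieves (Seq evaluate record_best) s1
        (14 + (n + 1) * (max_cost hinge_step + 13) + max_cost record_best)
        (best_of (insert (x, y, z) V))"
      proof (rule achieves_Seq[OF achieves_evaluate[OF s1(2,3) xyz]])
        fix s2 assume s2: "framed evaluate s1 s2" "snd s2 ''f'' 0 = dual_value x y z"
        have best: "best_of V s2"
          by (rule best_of_framed[OF s2(1) s1(1)]) (simp_all add: program_defs)
        have xy: "snd s2 ''x'' 0 = x" "snd s2 ''y'' 0 = y"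
          using s2(1) xyz by (auto simp: framed_def program_defs)
        show "achieves record_best s2 (max_cost record_best) (best_of (insert (x, y, z) V))"
        proof (rule achieves_loop_free)
          show "loop_free record_best" by (simp add: program_defs)
          show "best_of (insert (x, y, z) V) (effect record_best s2)"
          proof (cases "snd s2 ''value'' 0 < dual_value x y z")
            case True
            then show ?thesis using best f xy s2(2)
              by (fastforce simp: record_best_def best_of_def input_in_def coefs_in_def)
          next
            case False
            then show ?thesis using best s2(2) by (auto simp: record_best_def best_of_def)
          qed
        qed
      qed
    next
      assume "\<not> bval feasible_test s1"
      then have "\<not> feasible x y z" using bval_feasible_test[OF s1(2) xyz] by simp
      then have "best_of (insert (x, y, z) V) s1" using s1(1) by (simp add: best_of_def)
      then have "achieves Skip s1 1 (best_of (insert (x, y, z) V))"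
        using achieves_loop_free[of Skip _ s1] by simp
      then show "achieves Skip s1
        (14 + (n + 1) * (max_cost hinge_step + 13) + max_cost record_best)
        (best_of (insert (x, y, z) V))"
        by (rule achieves_weaken) auto
    qed
    then show ?thesis by (rule achieves_weaken) (auto simp: visit_cost_def)
  qed
  show ?thesis
    unfolding visit_def assign_def[symmetric] by (rule achieves_Seq[OF assign rest])
qed

lemma achieves_visit_candidates:
  assumes ijk: "fst s ''i'' 0 = i" "fst s ''j'' 0 = j" "fst s ''k'' 0 = k" "i \<le> n" "j \<le> n" "k \<le> n"
    and s: "best_of V s"
  shows "achieves visit_candidates s (72 + 4 * visit_cost) (best_of (V \<union> candidates i j k))"
proof -
  define a b c where "a = RCell ''r'' (nat_var ''i'')" and "b = RCell ''r'' (nat_var ''j'')"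
    and "c = RCell ''r'' (nat_var ''k'')"
  define idx where "idx s' \<longleftrightarrow>
    fst s' ''i'' 0 = i \<and> fst s' ''j'' 0 = j \<and> fst s' ''k'' 0 = k" for s' :: mem
  have keep: "idx s''" if "framed (visit a' b' c') s' s''" "idx s'" for s' s'' a' b' c'
    using that by (auto simp: framed_def idx_def program_defs)
  have vals: "snd s' ''r'' i = r i" "snd s' ''r'' j = r j" "snd s' ''r'' k = r k"
    if "best_of W s'" for W s' using that ijk by (auto simp: best_of_def input_in_def)
  have 1: "achieves (visit a b c) s' (15 + visit_cost) (best_of (insert (r i, r j, r k) W))"
    if "idx s'" "best_of W s'" for W s'
    by (rule achieves_weaken, rule achieves_visit[OF that(2)])
      (use that(1) vals[OF that(2)] in \<open>simp_all add: a_def b_def c_def idx_def\<close>)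
  have 2: "achieves (visit a b (RAdd a b)) s' (19 + visit_cost)
      (best_of (insert (r i, r j, r i + r j) W))"
    if "idx s'" "best_of W s'" for W s'
    by (rule achieves_weaken, rule achieves_visit[OF that(2)])
      (use that(1) vals[OF that(2)] in \<open>simp_all add: a_def b_def c_def idx_def\<close>)
  have 3: "achieves (visit a (RSub c a) c) s' (19 + visit_cost)
      (best_of (insert (r i, r k - r i, r k) W))"
    if "idx s'" "best_of W s'" for W s'
    by (rule achieves_weaken, rule achieves_visit[OF that(2)])
      (use that(1) vals[OF that(2)] in \<open>simp_all add: a_def b_def c_def idx_def\<close>)
  have 4: "achieves (visit (RSub c b) b c) s' (19 + visit_cost)
      (best_of (insert (r k - r j, r j, r k) W))"
    if "idx s'" "best_of W s'" for W s'
    by (rule achieves_weaken, rule achieves_visit[OF that(2)])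
      (use that(1) vals[OF that(2)] in \<open>simp_all add: a_def b_def c_def idx_def\<close>)
  have idx: "idx s" using ijk by (simp add: idx_def)
  have "achieves visit_candidates s ((15 + visit_cost) + ((19 + visit_cost) +
      ((19 + visit_cost) + (19 + visit_cost))))
      (best_of (insert (r k - r j, r j, r k) (insert (r i, r k - r i, r k)
        (insert (r i, r j, r i + r j) (insert (r i, r j, r k) V)))))"
    unfolding visit_candidates_def Let_def a_def[symmetric] b_def[symmetric] c_def[symmetric]
    by (intro achieves_Seq[OF 1[OF idx s]] achieves_Seq[OF 2] achieves_Seq[OF 3] 4)
      (use idx keep in blast)+
  then show ?thesis
    by (rule achieves_weaken) (auto simp: candidates_def insert_commute Un_commute)
qed

text \<open>
  The iterations may start with any set of points already visited, which lets sweeps be nested.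
\<close>

lemma achieves_sweep:
  assumes i: "i \<notin> {''n'', ''S'', ''assortment''}" "i \<notin> nat_writes c" "''n'' \<notin> nat_writes c"
    and s: "best_of V s"
    and step: "\<And>m W s'. m \<le> n \<Longrightarrow> framed (for_products i c) s s' \<Longrightarrow> fst s' i 0 = m \<Longrightarrow>
      best_of W s' \<Longrightarrow> achieves c s' T (best_of (W \<union> X m))"
  shows "achieves (for_products i c) s (10 + (n + 1) * (T + 13)) (best_of (V \<union> (\<Union>m\<le>n. X m)))"
proof -
  have "achieves (for_products i c) s (10 + (n + 1) * (T + 13))
      ((\<lambda>m. best_of (V \<union> (\<Union>l<m. X l))) (Suc n))"
  proof (rule achieves_for_products)
    show "fst s ''n'' 0 = n" using s by (simp add: best_of_def input_in_def)
    show "best_of (V \<union> (\<Union>l<m. X l)) (set_nat i a s')" if "best_of (V \<union> (\<Union>l<m. X l)) s'" for m s' a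
      using best_of_set_nat[OF i(1) that] .
    fix m s' assume m: "m \<le> n" "framed (for_products i c) s s'" "fst s' i 0 = m"
      "best_of (V \<union> (\<Union>l<m. X l)) s'"
    have eq: "V \<union> (\<Union>l<Suc m. X l) = V \<union> (\<Union>l<m. X l) \<union> X m" by (auto simp: less_Suc_eq)
    show "achieves c s' T (best_of (V \<union> (\<Union>l<Suc m. X l)))"
      unfolding eq by (rule step[OF m])
  qed (use i s in auto)
  then show ?thesis by (simp add: lessThan_Suc_atMost)
qed

definition search_cost :: nat where
  "search_cost = 10 + (n + 1) *
     (10 + (n + 1) * (10 + (n + 1) * (72 + 4 * visit_cost + 13) + 13) + 13)"

lemma achieves_search:
  assumes "best_of V s"
  shows "achieves search s search_cost (best_of (V \<union> (\<Union>i\<le>n. \<Union>j\<le>n. \<Union>k\<le>n. candidates i j k)))"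
  unfolding search_def search_cost_def
proof (rule achieves_sweep[OF _ _ _ assms])
  fix i V s1 assume i: "i \<le> n" "fst s1 ''i'' 0 = i" and s1: "best_of V s1"
  show "achieves (for_products ''j'' (for_products ''k'' visit_candidates)) s1
    (10 + (n + 1) * (10 + (n + 1) * (72 + 4 * visit_cost + 13) + 13))
    (best_of (V \<union> (\<Union>j\<le>n. \<Union>k\<le>n. candidates i j k)))"
  proof (rule achieves_sweep[OF _ _ _ s1])
    fix j V s2 assume j: "j \<le> n" "fst s2 ''j'' 0 = j" and s2: "best_of V s2"
      and fr2: "framed (for_products ''j'' (for_products ''k'' visit_candidates)) s1 s2"
    have i2: "fst s2 ''i'' 0 = i" using fr2 i(2) by (auto simp: framed_def program_defs Let_def)
    show "achieves (for_products ''k'' visit_candidates) s2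
      (10 + (n + 1) * (72 + 4 * visit_cost + 13)) (best_of (V \<union> (\<Union>k\<le>n. candidates i j k)))"
    proof (rule achieves_sweep[OF _ _ _ s2])
      fix k V s3 assume k: "k \<le> n" "fst s3 ''k'' 0 = k" and s3: "best_of V s3"
        and fr3: "framed (for_products ''k'' visit_candidates) s2 s3"
      have ij3: "fst s3 ''i'' 0 = i" "fst s3 ''j'' 0 = j"
        using fr3 i2 j(2) by (auto simp: framed_def program_defs Let_def)
      show "achieves visit_candidates s3 (72 + 4 * visit_cost) (best_of (V \<union> candidates i j k))"
        by (rule achieves_visit_candidates[OF ij3 k(2) i(1) j(1) k(1) s3])
    qed (simp_all add: program_defs Let_def)
  qed (simp_all add: program_defs Let_def)
qed (simp_all add: program_defs Let_def)

lemma achieves_output: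
  assumes s: "input_in s" "fst s ''assortment'' = (\<lambda>_. 0)"
    and xy: "snd s ''bx'' 0 = x" "snd s ''by'' 0 = y"
  shows "achieves (for_products ''l'' output_step) s (10 + (n + 1) * (max_cost output_step + 13))
    (\<lambda>s'. output_assortment I s' = offered x y)"
proof -
  define Q where "Q m s' \<longleftrightarrow> (\<forall>k. fst s' ''assortment'' k \<noteq> 0 \<longleftrightarrow> k < m \<and> k \<in> offered x y)"
    for m and s' :: mem
  have "achieves (for_products ''l'' output_step) s (10 + (n + 1) * (max_cost output_step + 13))
    (Q (Suc n))"
  proof (rule achieves_for_products)
    show "fst s ''n'' 0 = n" using s by (simp add: input_in_def)
    fix k s' assume k: "k \<le> n" "framed (for_products ''l'' output_step) s s'" "fst s' ''l'' 0 = k"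
      "Q k s'"
    have s': "input_in s'"
      by (rule input_in_framed[OF k(2) s(1)]) (simp_all add: program_defs Let_def)
    have v: "(fst s' ''S'' k = 0) = (k \<notin> S1)" "(fst s' ''S'' (Suc (n + k)) = 0) = (k \<notin> S2)"
      "fst s' ''n'' 0 = n" "snd s' ''r'' k = r k"
      using s' k(1) by (auto simp: input_in_def)
    have xy': "snd s' ''bx'' 0 = x" "snd s' ''by'' 0 = y"
      using k(2) xy by (auto simp: framed_def program_defs Let_def)
    have off: "k \<in> offered x y \<longleftrightarrow> (k \<in> S2 \<or> x \<le> r k) \<and> (k \<in> S1 \<or> y \<le> r k)"
      using k(1) by (auto simp: offered_def P_eq)
    show "achieves output_step s' (max_cost output_step) (Q (Suc k))"
    proof (rule achieves_loop_free)
      show "loop_free output_step" by (simp add: program_defs Let_def)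
      show "Q (Suc k) (effect output_step s')"
        using k(3,4) v xy' off by (auto simp: program_defs Let_def Q_def less_Suc_eq not_less)
    qed
  qed (use s in \<open>auto simp: program_defs Let_def Q_def set_nat_def\<close>)
  then show ?thesis
  proof (rule achieves_weaken)
    fix s' assume "Q (Suc n) s'"
    then show "output_assortment I s' = offered x y"
      by (auto simp: Q_def output_assortment_def offered_def P_eq less_Suc_eq_le)
  qed simp
qed

definition solver_cost :: nat where
  "solver_cost = (10 + (n + 1) * (max_cost coef_step + 13)) +
     (search_cost + (10 + (n + 1) * (max_cost output_step + 13)))"

theorem solver_correct:
  assumes ne: "consistent \<noteq> {}"
  shows "achieves solver (input_mem I) solver_cost
    (\<lambda>s. robust_optimum N 0 I (output_assortment I s) (output_value s))"
  unfolding solver_def solver_cost_def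
proof (rule achieves_Seq[OF achieves_coefs[OF input_mem_in]])
  fix s1 assume s1: "framed (for_products ''l'' coef_step) (input_mem I) s1" "coefs_in (Suc n) s1"
  have "input_in s1"
    by (rule input_in_framed[OF s1(1) input_mem_in]) (simp_all add: program_defs Let_def)
  moreover have "fst s1 ''assortment'' = (\<lambda>_. 0)" "snd s1 ''bx'' = (\<lambda>_. 0)" "snd s1 ''by'' = (\<lambda>_. 0)"
    "snd s1 ''value'' = (\<lambda>_. 0)"
    using s1(1) by (simp_all add: framed_def program_defs Let_def input_mem_def)
  ultimately have "best_of {} s1"
    using s1(2) feasible_zero dual_value_zero by (auto simp: best_of_def)
  from achieves_search[OF this]
  show "achieves (Seq search (for_products ''l'' output_step)) s1
    (search_cost + (10 + (n + 1) * (max_cost output_step + 13)))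
    (\<lambda>s. robust_optimum N 0 I (output_assortment I s) (output_value s))"
  proof (rule achieves_Seq)
    fix s2 assume "best_of ({} \<union> (\<Union>i\<le>n. \<Union>j\<le>n. \<Union>k\<le>n. candidates i j k)) s2"
    then have best: "best_of (\<Union>i\<le>n. \<Union>j\<le>n. \<Union>k\<le>n. candidates i j k) s2" by simp
    define x y where "x = snd s2 ''bx'' 0" and "y = snd s2 ''by'' 0"
    obtain z where z: "feasible x y z" "snd s2 ''value'' 0 = dual_value x y z"
      using best unfolding best_of_def x_def y_def by blast
    have opt: "robust_optimum N 0 I (offered x y) (dual_value x y z)"
    proof (rule best_candidate_optimal[OF ne z(1)])
      fix i j k x' y' z' assume "i \<in> P" "j \<in> P" "k \<in> P" "(x', y', z') \<in> candidates i j k"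
        "feasible x' y' z'"
      moreover from this have "(x', y', z') \<in> (\<Union>i\<le>n. \<Union>j\<le>n. \<Union>k\<le>n. candidates i j k)"
        by (auto simp: P_eq)
      ultimately show "dual_value x' y' z' \<le> dual_value x y z"
        using best z(2) unfolding best_of_def by fastforce
    qed
    have "input_in s2" "fst s2 ''assortment'' = (\<lambda>_. 0)" using best by (auto simp: best_of_def)
    from achieves_output[OF this x_def[symmetric] y_def[symmetric]]
    show "achieves (for_products ''l'' output_step) s2 (10 + (n + 1) * (max_cost output_step + 13))
      (\<lambda>s. robust_optimum N 0 I (output_assortment I s) (output_value s))"
    proof (rule achieves_weaken)
      fix s3 assume s3: "framed (for_products ''l'' output_step) s2 s3"
        "output_assortment I s3 = offered x y"
      have "snd s3 ''value'' = snd s2 ''value''"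
        using s3(1) by (simp add: framed_def program_defs Let_def)
      then show "robust_optimum N 0 I (output_assortment I s3) (output_value s3)"
        using opt z(2) s3(2) by (simp add: output_value_def)
    qed simp
  qed
qed

end

text \<open>
  The factor grows by the same amount with every level of nesting, so it stays independent of the
  instance.
\<close>

lemma loop_cost_le:
  fixes N :: nat
  assumes "T \<le> b * N ^ j" "1 \<le> N"
  shows "10 + N * (T + 13) \<le> (b + 23) * N ^ Suc j"
proof -
  have "13 \<le> 13 * N ^ j" "10 \<le> 10 * N ^ Suc j" using assms(2) by auto
  then have "10 + N * (T + 13) \<le> 10 * N ^ Suc j + N * (b * N ^ j + 13 * N ^ j)"
    using assms(1) by (intro add_mono mult_left_mono) auto
  then show ?thesis by (simp add: algebra_simps)
qed

text \<open>These constants depend only on the program text, so they serve all instances.\<close>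

definition visit_factor :: nat where
  "visit_factor = bcost feasible_test + max_cost record_best + max_cost hinge_step + 29"

definition solver_factor :: nat where
  "solver_factor =
     (max_cost coef_step + 23) + (72 + 4 * visit_factor + 69) + (max_cost output_step + 23)"

lemma (in two_past_assortments) solver_cost_le: "solver_cost \<le> solver_factor * (n + 1) ^ 4"
proof -
  define N where "N = n + 1"
  have N: "1 \<le> N" by (simp add: N_def)
  have "bcost feasible_test + max_cost record_best + 16
      \<le> (bcost feasible_test + max_cost record_best + 16) * N" using N by simp
  then have "visit_cost \<le> visit_factor * N"
    unfolding visit_cost_def visit_factor_def N_def[symmetric] by (simp add: algebra_simps)
  then have "72 + 4 * visit_cost \<le> (72 + 4 * visit_factor) * N ^ 1"
    using N by (simp add: algebra_simps)
  from loop_cost_le[OF loop_cost_le[OF loop_cost_le[OF this N] N] N]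
  have search: "search_cost \<le> (72 + 4 * visit_factor + 69) * N ^ 4"
    unfolding search_cost_def N_def[symmetric] by (simp add: eval_nat_numeral)
  have linear: "10 + N * (c + 13) \<le> (c + 23) * N ^ 4" for c
  proof -
    have "10 + N * (c + 13) \<le> (c + 23) * N ^ Suc 0" using N by (intro loop_cost_le) auto
    also have "\<dots> \<le> (c + 23) * N ^ 4" using N by (intro mult_left_mono power_increasing) auto
    finally show ?thesis .
  qed
  show ?thesis
    unfolding solver_cost_def solver_factor_def N_def[symmetric]
    using linear[of "max_cost coef_step"] linear[of "max_cost output_step"] search
    by (simp add: distrib_right)
qed

theorem theorem3:
  fixes N :: norm_kind and \<eta> :: real
  assumes "\<eta> = 0"
  shows "robust_solvable_in_time N \<eta> {I. num_past I = 2 \<and> integer_revenues I}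
           (\<lambda>I. real (num_products I) ^ 5 *
                 max 1 (log 2 (real (num_products I) * revenue I (num_products I))))"
  unfolding robust_solvable_in_time_def
proof (rule exI[of _ solver], rule exI[of _ "real (16 * solver_factor)"], intro ballI impI)
  fix I assume "I \<in> {I. num_past I = 2 \<and> integer_revenues I}"
    and I: "wf_data I \<and> uncertainty_set N \<eta> I \<noteq> {}"
  then interpret two_past_assortments I by unfold_locales auto
  have "consistent \<noteq> {}" using I assms by (simp add: uncertainty_set_eq)
  from solver_correct[OF this] obtain t s where run: "exec solver (input_mem I) t s"
    "t \<le> solver_cost" "robust_optimum N 0 I (output_assortment I s) (output_value s)"
    unfolding achieves_def by blast
  have n1: "1 \<le> n" using wf by (simp add: wf_data_def)
  have "t \<le> solver_factor * (n + 1) ^ 4" using run(2) solver_cost_le by simp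
  also have "\<dots> \<le> solver_factor * (2 * n) ^ 4"
    using n1 by (intro mult_left_mono power_mono) auto
  also have "\<dots> \<le> 16 * solver_factor * n ^ 5"
    using n1 by (simp add: power_mult_distrib power_increasing)
  finally have "real t \<le> real (16 * solver_factor * n ^ 5)" by (rule of_nat_mono)
  also have "\<dots> = real (16 * solver_factor) * (real n ^ 5 * 1)" by simp
  also have "\<dots> \<le> real (16 * solver_factor) * (real n ^ 5 * max 1 (log 2 (real n * revenue I n)))"
    by (intro mult_left_mono) auto
  finally show "\<exists>t s. exec solver (input_mem I) t s \<and>
      real t \<le> real (16 * solver_factor) * (real n ^ 5 * max 1 (log 2 (real n * revenue I n))) \<and>
      robust_optimum N \<eta> I (output_assortment I s) (output_value s)"
    using run(1,3) assms by blast
qed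

end
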